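(* $\langle\Delta_2,\Delta_0\rangle(\mathcal C)$ is isomorphic to $\wedge^*$, the dual of $\wedge=\langle\Delta_2,\Delta_0\rangle(\ker\Delta_1)$.
   Context: All spaces are complex. For the couple $(X_0,X_1)=(\ell_\infty,\ell_1)$ put $\Sigma=\ell_\infty+\ell_1$. The Calderón space $\mathcal C$ of the couple is the Banach space of bounded continuous functions $F:\{z\in\mathbb C:0\le \mathrm{Re}\,z\le 1\}\to\Sigma$, analytic on the open strip, such that for $j=0,1$ the map $t\mapsto F(j+it)$ is continuous from $\mathbb R$ into $X_j$ and tends to $0$ as $|t|\to\infty$, with norm $\|F\|=\max_{j=0,1}\sup_{t}\|F(j+it)\|_{X_j}$. For $k=0,1,2$ let $\Delta_k:\mathcal C\to\Sigma$, $\Delta_k(F)=F^{(k)}(1/2)/k!$, and for distinct indices $\langle\Delta_a,\Delta_b\rangle(F)=(\Delta_aF,\Delta_bF)$. For a closed subspace $K\subset\mathcal C$ and one of these maps $T$, the space $T(K)$ carries the quotient norm $\|x\|=\inf\{\|F\|:F\in K,\ TF=x\}$. *)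

theory Defs
  imports "HOL-Analysis.Analysis" "HOL-Library.Function_Algebras"
begin

class complex_vector = ab_group_add +
  fixes scaleC :: "complex \<Rightarrow> 'a \<Rightarrow> 'a"  (infixr \<open>*\<^sub>C\<close> 75)
  assumes scaleC_add_right: "c *\<^sub>C (x + y) = c *\<^sub>C x + c *\<^sub>C y"
    and scaleC_add_left: "(c + d) *\<^sub>C x = c *\<^sub>C x + d *\<^sub>C x"
    and scaleC_scaleC: "c *\<^sub>C d *\<^sub>C x = (c * d) *\<^sub>C x"
    and scaleC_one: "1 *\<^sub>C x = x"

instantiation complex :: complex_vector
begin
definition scaleC_complex :: "complex \<Rightarrow> complex \<Rightarrow> complex"
  where "scaleC_complex c x = c * x"
instance by standard (simp_all add: scaleC_complex_def algebra_simps)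
end

instantiation "fun" :: (type, complex_vector) complex_vector
begin
definition scaleC_fun :: "complex \<Rightarrow> ('a \<Rightarrow> 'b) \<Rightarrow> 'a \<Rightarrow> 'b"
  where "scaleC_fun c f = (\<lambda>i. c *\<^sub>C f i)"
instance
  by standard (simp_all add: scaleC_fun_def fun_eq_iff scaleC_add_right scaleC_add_left
      scaleC_scaleC scaleC_one)
end

instantiation prod :: (complex_vector, complex_vector) complex_vector
begin
definition scaleC_prod :: "complex \<Rightarrow> 'a \<times> 'b \<Rightarrow> 'a \<times> 'b"
  where "scaleC_prod c p = (c *\<^sub>C fst p, c *\<^sub>C snd p)"
instance
  by standard (simp_all add: scaleC_prod_def prod_eq_iff scaleC_add_right scaleC_add_left
      scaleC_scaleC scaleC_one)
end

text \<open>A complex normed space is given by a linear subspace of an ambient complex vector space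
  together with a norm whose values are relevant on that subspace only.\<close>

record 'a nspace =
  vecs :: "'a set"
  vnorm :: "'a \<Rightarrow> real"

definition clinear_on :: "'a::complex_vector set \<Rightarrow> ('a \<Rightarrow> 'b::complex_vector) \<Rightarrow> bool" where
  "clinear_on V T \<longleftrightarrow> (\<forall>x\<in>V. \<forall>y\<in>V. T (x + y) = T x + T y) \<and> (\<forall>c. \<forall>x\<in>V. T (c *\<^sub>C x) = c *\<^sub>C T x)"

definition isomorphic :: "'a::complex_vector nspace \<Rightarrow> 'b::complex_vector nspace \<Rightarrow> bool" where
  "isomorphic X Y \<longleftrightarrow>
     (\<exists>T. clinear_on (vecs X) T \<and> bij_betw T (vecs X) (vecs Y) \<and>
        (\<exists>B. \<forall>x\<in>vecs X. vnorm Y (T x) \<le> B * vnorm X x) \<and>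
        (\<exists>B. \<forall>y\<in>vecs Y. vnorm X (inv_into (vecs X) T y) \<le> B * vnorm Y y))"

text \<open>Functionals are extended by zero off the space, so that equality of functionals is
  equality on the space.\<close>

definition dual :: "'a::complex_vector nspace \<Rightarrow> ('a \<Rightarrow> complex) nspace" where
  "dual X =
     \<lparr>vecs = {\<phi>. clinear_on (vecs X) \<phi> \<and> (\<exists>B. \<forall>x\<in>vecs X. cmod (\<phi> x) \<le> B * vnorm X x) \<and>
                (\<forall>x. x \<notin> vecs X \<longrightarrow> \<phi> x = 0)},
      vnorm = (\<lambda>\<phi>. SUP x\<in>{x \<in> vecs X. vnorm X x \<le> 1}. cmod (\<phi> x))\<rparr>"

definition sum_space :: "'a::complex_vector nspace \<Rightarrow> 'a nspace \<Rightarrow> 'a nspace" where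
  "sum_space X0 X1 =
     \<lparr>vecs = {x0 + x1 | x0 x1. x0 \<in> vecs X0 \<and> x1 \<in> vecs X1},
      vnorm = (\<lambda>x. Inf {vnorm X0 x0 + vnorm X1 x1 | x0 x1.
                          x0 \<in> vecs X0 \<and> x1 \<in> vecs X1 \<and> x = x0 + x1})\<rparr>"

definition image_space :: "('a \<Rightarrow> 'b) \<Rightarrow> 'a nspace \<Rightarrow> 'a set \<Rightarrow> 'b nspace" where
  "image_space T X K =
     \<lparr>vecs = T ` K, vnorm = (\<lambda>x. Inf {vnorm X F | F. F \<in> K \<and> T F = x})\<rparr>"

definition continuous_into ::
  "'a::complex_vector nspace \<Rightarrow> 'b::topological_space set \<Rightarrow> ('b \<Rightarrow> 'a) \<Rightarrow> bool" where
  "continuous_into X S f \<longleftrightarrow>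
     f ` S \<subseteq> vecs X \<and> (\<forall>s\<in>S. ((\<lambda>t. vnorm X (f t - f s)) \<longlongrightarrow> 0) (at s within S))"

definition has_vderiv ::
  "'a::complex_vector nspace \<Rightarrow> (complex \<Rightarrow> 'a) \<Rightarrow> 'a \<Rightarrow> complex \<Rightarrow> bool" where
  "has_vderiv X F D z \<longleftrightarrow> D \<in> vecs X \<and>
     ((\<lambda>w. vnorm X (inverse (w - z) *\<^sub>C (F w - F z) - D)) \<longlongrightarrow> 0) (at z)"

definition vderiv :: "'a::complex_vector nspace \<Rightarrow> (complex \<Rightarrow> 'a) \<Rightarrow> complex \<Rightarrow> 'a" where
  "vderiv X F z = (THE D. has_vderiv X F D z)"

definition strip :: "complex set" where
  "strip = {z. 0 \<le> Re z \<and> Re z \<le> 1}"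

definition open_strip :: "complex set" where
  "open_strip = {z. 0 < Re z \<and> Re z < 1}"

definition boundary_ok :: "'a::complex_vector nspace \<Rightarrow> (real \<Rightarrow> 'a) \<Rightarrow> bool" where
  "boundary_ok X f \<longleftrightarrow> continuous_into X UNIV f \<and> ((\<lambda>t. vnorm X (f t)) \<longlongrightarrow> 0) at_infinity"

text \<open>Functions on the strip are represented by their extension by zero.\<close>

definition calderon ::
  "'a::complex_vector nspace \<Rightarrow> 'a nspace \<Rightarrow> (complex \<Rightarrow> 'a) nspace" where
  "calderon X0 X1 =
     \<lparr>vecs = {F. continuous_into (sum_space X0 X1) strip F \<and>
                (\<exists>B. \<forall>z\<in>strip. vnorm (sum_space X0 X1) (F z) \<le> B) \<and>
                (\<forall>z\<in>open_strip. \<exists>D. has_vderiv (sum_space X0 X1) F D z) \<and>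
                boundary_ok X0 (\<lambda>t. F (Complex 0 t)) \<and>
                boundary_ok X1 (\<lambda>t. F (Complex 1 t)) \<and>
                (\<forall>z. z \<notin> strip \<longrightarrow> F z = 0)},
      vnorm = (\<lambda>F. max (SUP t. vnorm X0 (F (Complex 0 t))) (SUP t. vnorm X1 (F (Complex 1 t))))\<rparr>"

definition taylor_coeff ::
  "'a::complex_vector nspace \<Rightarrow> nat \<Rightarrow> (complex \<Rightarrow> 'a) \<Rightarrow> 'a" where
  "taylor_coeff X k F = inverse (fact k :: complex) *\<^sub>C (vderiv X ^^ k) F (1/2)"

definition ell_inf :: "(nat \<Rightarrow> complex) nspace" where
  "ell_inf = \<lparr>vecs = {x. bounded (range x)}, vnorm = (\<lambda>x. SUP n. cmod (x n))\<rparr>"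

definition ell_1 :: "(nat \<Rightarrow> complex) nspace" where
  "ell_1 = \<lparr>vecs = {x. summable (\<lambda>n. cmod (x n))}, vnorm = (\<lambda>x. \<Sum>n. cmod (x n))\<rparr>"

definition Calderon :: "(complex \<Rightarrow> nat \<Rightarrow> complex) nspace" where
  "Calderon = calderon ell_inf ell_1"

definition Delta :: "nat \<Rightarrow> (complex \<Rightarrow> nat \<Rightarrow> complex) \<Rightarrow> nat \<Rightarrow> complex" where
  "Delta k F = taylor_coeff (sum_space ell_inf ell_1) k F"

definition Delta_pair ::
  "nat \<Rightarrow> nat \<Rightarrow> (complex \<Rightarrow> nat \<Rightarrow> complex) \<Rightarrow> (nat \<Rightarrow> complex) \<times> (nat \<Rightarrow> complex)" where
  "Delta_pair a b F = (Delta a F, Delta b F)"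

definition ker_Delta :: "nat \<Rightarrow> (complex \<Rightarrow> nat \<Rightarrow> complex) set" where
  "ker_Delta k = {F \<in> vecs Calderon. Delta k F = 0}"

definition Wedge :: "((nat \<Rightarrow> complex) \<times> (nat \<Rightarrow> complex)) nspace" where
  "Wedge = image_space (Delta_pair 2 0) Calderon (ker_Delta 1)"

end

theory Submission imports Defs "HOL-Complex_Analysis.Complex_Analysis" begin

text \<open>The pairing \<open>(w, x), (w', x') \<mapsto> \<Sum>n. w n * x' n + x n * w' n\<close> implements the isomorphism. If
  \<open>(w, x)\<close> comes from \<open>F\<close> and \<open>(w', x')\<close> from \<open>G\<close> with \<open>\<Delta>\<^sub>1 G = 0\<close>, it is the second Taylor
  coefficient at \<open>1/2\<close> of \<open>\<Sum>n. F z n * G (1 - z) n\<close>, which is bounded on the strip by the product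
  of the norms because \<open>z \<mapsto> 1 - z\<close> exchanges the two boundary lines.

  For surjectivity, a functional \<open>\<phi>\<close> on \<open>Wedge\<close> gives \<open>x n = \<phi> (e\<^sub>n, 0)\<close>, a square summable sequence,
  and after subtracting the functional induced by some \<open>F\<close> with \<open>\<Delta>\<^sub>0 F = x\<close> one may assume that
  \<open>\<phi> (e\<^sub>n, 0) = 0\<close>. Then \<open>\<psi> n = \<phi> (0, e\<^sub>n)\<close> is bounded on the domain of the Kalton--Peck map, so writing
  \<open>\<bar>\<psi> n\<bar> = s n * ln (1 / s n)\<close> one finds \<open>s\<close> square summable, and \<open>\<psi>\<close> is attained as \<open>\<Delta>\<^sub>2 H\<close> for an
  explicit \<open>H\<close> with \<open>\<Delta>\<^sub>0 H = 0\<close>. The functions used have coordinates \<open>x n * exp ((2 * z - 1) * r n)\<close> with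
  \<open>r n\<close> slightly larger than \<open>ln \<bar>x n\<bar>\<close>, since for \<open>r n = ln \<bar>x n\<bar>\<close> the boundary values would not be
  norm continuous. Density of the finitely supported pairs in \<open>Wedge\<close> finishes the proof.\<close>

text \<open>In each coordinate the second coefficient of the reflected product also contains
  \<open>- Delta 1 F * Delta 1 G\<close>. For unrestricted \<open>F\<close> it vanishes because
  \<open>Delta 1 G = 0\<close>, which is why the kernel stands on one side of the duality and the
  whole space on the other. The norm of a test function is controlled by a majorant \<open>q\<close>
  of its polynomial coefficients, through the supremum of \<open>q * exp (- r)\<close> and the sum
  of \<open>q * exp r\<close>. A value \<open>a\<close> with \<open>Delta 1 = 0\<close> forces the
  linear coefficient \<open>- 2 * r * a\<close>, so \<open>a\<close> must be smaller than
  \<open>q\<close> by a factor of order \<open>r\<close>. This is the origin of the logarithm, hence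
  of the weights \<open>s / L\<close> and \<open>s * L\<close> with \<open>L = ln (1 / s)\<close>.
  Functionals are scaled to have bound 1/48. The test functions have norm at most 12 or 24 times
  \<open>max 1 S\<close>, so that \<open>S \<le> max 1 S / 2\<close> and thus
  \<open>S \<le> 1\<close>; the same scale makes every \<open>\<psi> n\<close> at most
  \<open>exp (-1)\<close> in modulus, the largest value of \<open>s * ln (1 / s)\<close>.\<close>

section \<open>Bounded holomorphic functions on the strip\<close>

lemma open_strip_eq: "open_strip = {z. 0 < Re z} \<inter> {z. Re z < 1}"
  by (auto simp: open_strip_def)

lemma open_open_strip: "open open_strip"
  by (auto simp: open_strip_eq intro!: open_halfspace_Re_gt open_halfspace_Re_lt)

lemma open_strip_subset: "open_strip \<subseteq> strip"
  by (auto simp: strip_def open_strip_def)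

lemma half_in_open_strip: "1/2 \<in> open_strip"
  by (simp add: open_strip_def)

lemma ball_half_subset: "ball (1/2) (1/2) \<subseteq> open_strip" "cball (1/2) (1/2) \<subseteq> strip"
proof -
  have *: "\<bar>1/2 - Re z\<bar> \<le> dist (1/2) z" for z :: complex
    using abs_Re_le_cmod[of "1/2 - z"] by (simp add: dist_norm)
  show "ball (1/2) (1/2) \<subseteq> open_strip"
  proof
    fix z :: complex assume "z \<in> ball (1/2) (1/2)"
    then show "z \<in> open_strip" using *[of z] by (auto simp: open_strip_def)
  qed
  show "cball (1/2) (1/2) \<subseteq> strip"
  proof
    fix z :: complex assume "z \<in> cball (1/2) (1/2)"
    then show "z \<in> strip" using *[of z] by (auto simp: strip_def)
  qed
qed

text \<open>The factor \<open>exp (\<epsilon> * (z\<^sup>2 - 1))\<close> makes the function small on the horizontal sides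
  of a long rectangle, to which the maximum principle applies.\<close>

lemma strip_max_principle:
  assumes cont: "continuous_on strip f" and hol: "f holomorphic_on open_strip"
    and B: "\<And>z. z \<in> strip \<Longrightarrow> cmod (f z) \<le> B"
    and M: "\<And>z. z \<in> strip \<Longrightarrow> Re z = 0 \<or> Re z = 1 \<Longrightarrow> cmod (f z) \<le> M"
    and z: "z \<in> strip"
  shows "cmod (f z) \<le> M"
proof -
  have M0: "0 \<le> M"
    using order_trans[OF norm_ge_zero M[of 0]] by (simp add: strip_def)
  have B0: "0 \<le> B" using B[OF z] norm_ge_zero order_trans by blast
  have sq: "Re (w\<^sup>2) = (Re w)\<^sup>2 - (Im w)\<^sup>2" for w by (simp add: power2_eq_square)
  \<comment> \<open>On the vertical sides the factor has modulus at most 1, because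
    \<open>Re (w\<^sup>2) \<le> 1\<close> on the strip; the slack \<open>e\<close> on the right
    absorbs the horizontal sides, where the Gaussian decay beats \<open>B\<close>.\<close>
  have key: "cmod (f z) * exp (e * (Re (z\<^sup>2) - 1)) \<le> M + e" if e: "e > 0" for e
  proof -
    define g where "g w = f w * exp (of_real e * (w\<^sup>2 - 1))" for w
    have ng: "cmod (g w) = cmod (f w) * exp (e * (Re (w\<^sup>2) - 1))" for w
      by (simp add: g_def norm_mult)
    obtain R where R: "R > \<bar>Im z\<bar>" "B * exp (- (e * R\<^sup>2)) \<le> e"
    proof -
      have "((\<lambda>R. B * exp (- (e * R\<^sup>2))) \<longlongrightarrow> 0) at_top"
        using e by real_asymp
      then have "\<forall>\<^sub>F R in at_top. B * exp (- (e * R\<^sup>2)) < e"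
        using e order_tendstoD(2) by blast
      moreover have "\<forall>\<^sub>F R in at_top. R > \<bar>Im z\<bar>" by (rule eventually_gt_at_top)
      ultimately have "\<forall>\<^sub>F R in at_top. R > \<bar>Im z\<bar> \<and> B * exp (- (e * R\<^sup>2)) < e"
        by eventually_elim auto
      then obtain R where "R > \<bar>Im z\<bar>" "B * exp (- (e * R\<^sup>2)) < e"
        using eventually_happens'[OF trivial_limit_at_top_linorder] by blast
      then show thesis using that by simp
    qed
    define S where "S = cbox (Complex 0 (-R)) (Complex 1 R)"
    have S: "w \<in> S \<longleftrightarrow> 0 \<le> Re w \<and> Re w \<le> 1 \<and> -R \<le> Im w \<and> Im w \<le> R" for w
      by (auto simp: S_def in_cbox_complex_iff)
    have int: "interior S = box (Complex 0 (-R)) (Complex 1 R)"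
      by (simp add: S_def interior_cbox)
    have Ssub: "S \<subseteq> strip" "interior S \<subseteq> open_strip"
      by (auto simp: int in_box_complex_iff open_strip_def strip_def S)
    have "norm (g z) \<le> M + e"
    proof (rule maximum_modulus_frontier[where S = S and f = g and \<xi> = z])
      show "g holomorphic_on interior S" unfolding g_def
        by (intro holomorphic_intros holomorphic_on_subset[OF hol] Ssub)
      show "continuous_on (closure S) g"
        unfolding g_def S_def closure_cbox
        by (intro continuous_intros continuous_on_subset[OF cont]) (use Ssub S_def in auto)
      show "bounded S" by (simp add: S_def)
      show "z \<in> S" using R(1) z by (auto simp: S strip_def)
      fix w assume "w \<in> frontier S"
      then have wS: "w \<in> S" and wf: "w \<notin> interior S"
        by (auto simp: frontier_def S_def)
      have Re1: "(Re w)\<^sup>2 \<le> 1" using wS by (auto simp: S power_le_one_iff)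
      from wS wf consider "Re w = 0 \<or> Re w = 1" | "\<bar>Im w\<bar> = R"
        by (auto simp: int in_box_complex_iff S)
      then show "norm (g w) \<le> M + e"
      proof cases
        case 1
        have "exp (e * (Re (w\<^sup>2) - 1)) \<le> 1"
          using e order_trans[OF Re1, of "1 + (Im w)\<^sup>2"] by (simp add: sq mult_le_0_iff)
        then have "cmod (g w) \<le> cmod (f w)"
          unfolding ng by (simp add: mult_left_le)
        also have "\<dots> \<le> M" using M[of w] 1 wS Ssub by auto
        finally show ?thesis using e by simp
      next
        case 2
        then have "(Im w)\<^sup>2 = R\<^sup>2" by (metis power2_abs)
        then have "e * (Re (w\<^sup>2) - 1) \<le> - (e * R\<^sup>2)"
          using Re1 e by (simp add: sq algebra_simps)
        then have "cmod (g w) \<le> B * exp (- (e * R\<^sup>2))"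
          unfolding ng using B[of w] B0 wS Ssub by (intro mult_mono) auto
        then show ?thesis using R M0 by linarith
      qed
    qed
    then show ?thesis by (simp add: ng)
  qed
  have "((\<lambda>e. cmod (f z) * exp (e * (Re (z\<^sup>2) - 1))) \<longlongrightarrow> cmod (f z) * exp (0 * (Re (z\<^sup>2) - 1))) (at_right 0)"
    by (intro tendsto_intros)
  moreover have "((\<lambda>e. M + e) \<longlongrightarrow> M + 0) (at_right 0)" by (intro tendsto_intros)
  moreover have "\<forall>\<^sub>F e in at_right 0. cmod (f z) * exp (e * (Re (z\<^sup>2) - 1)) \<le> M + e"
    using eventually_at_right_less by eventually_elim (rule key)
  ultimately have "cmod (f z) * exp (0 * (Re (z\<^sup>2) - 1)) \<le> M + 0"
    using tendsto_le trivial_limit_at_right_real by blast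
  then show ?thesis by simp
qed

text \<open>Multiplying by \<open>exp (l * z)\<close> with \<open>exp l = B / d\<close> raises the
  bound on the right line from \<open>d\<close> to \<open>B\<close> and leaves the left line
  unchanged; undoing the factor gives the interpolated power. On the left line the global bound
  serves, since only the right line will carry smallness.\<close>

lemma strip_three_lines:
  assumes cont: "continuous_on strip f" and hol: "f holomorphic_on open_strip"
    and B: "\<And>z. z \<in> strip \<Longrightarrow> cmod (f z) \<le> B"
    and d: "\<And>z. z \<in> strip \<Longrightarrow> Re z = 1 \<Longrightarrow> cmod (f z) \<le> d"
    and d0: "0 < d" "d \<le> B" and z: "z \<in> strip"
  shows "cmod (f z) \<le> B * (d / B) powr Re z"
proof -
  define l where "l = - ln (d / B)"
  have l0: "l \<ge> 0" using d0 by (simp add: l_def)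
  have el: "exp l = B / d" using d0 by (simp add: l_def exp_minus)
  define g where "g w = f w * exp (of_real l * w)" for w
  have ng: "cmod (g w) = cmod (f w) * exp (l * Re w)" for w
    by (simp add: g_def norm_mult)
  have "cmod (g z) \<le> B"
  proof (rule strip_max_principle[where B = "B * exp l" and f = g and z = z])
    show "continuous_on strip g" "g holomorphic_on open_strip"
      unfolding g_def by (intro continuous_intros cont holomorphic_intros hol)+
    show "z \<in> strip" by fact
    show "cmod (g w) \<le> B * exp l" if "w \<in> strip" for w
      unfolding ng using B[OF that] d0 that l0
      by (intro mult_mono) (auto simp: strip_def mult_left_le)
    show "cmod (g w) \<le> B" if w: "w \<in> strip" "Re w = 0 \<or> Re w = 1" for w
    proof (cases "Re w = 0")
      case True then show ?thesis using B w by (simp add: ng)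
    next
      case False
      then have "cmod (g w) \<le> d * exp l"
        using w d by (simp add: ng)
      also have "\<dots> = B" using el d0 by simp
      finally show ?thesis .
    qed
  qed
  then have "cmod (f z) \<le> B / exp (l * Re z)"
    by (simp add: ng field_simps)
  also have "\<dots> = B * (d / B) powr Re z"
    using d0 by (simp add: powr_def l_def exp_minus field_simps)
  finally show ?thesis .
qed

text \<open>The disc of radius 1/2 about 1/2 is inscribed in the strip, and Cauchy's inequality on
  it gives 2! / (1/2)^2 = 8. The maximum principle replaces the a priori bound \<open>B\<close> by
  the boundary bound \<open>M\<close> on its circle.\<close>

lemma strip_second_deriv_bound:
  assumes cont: "continuous_on strip f" and hol: "f holomorphic_on open_strip"
    and B: "\<And>z. z \<in> strip \<Longrightarrow> cmod (f z) \<le> B"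
    and M: "\<And>z. z \<in> strip \<Longrightarrow> Re z = 0 \<or> Re z = 1 \<Longrightarrow> cmod (f z) \<le> M"
  shows "cmod ((deriv ^^ 2) f (1/2)) \<le> 8 * M"
proof -
  have "cmod ((deriv ^^ 2) f (1/2)) \<le> fact 2 * M / (1/2) ^ 2"
  proof (rule Cauchy_inequality)
    show "f holomorphic_on ball (1/2) (1/2)"
      using hol ball_half_subset holomorphic_on_subset by blast
    show "continuous_on (cball (1/2) (1/2)) f"
      using cont ball_half_subset continuous_on_subset by blast
    fix x :: complex assume "cmod (1/2 - x) = 1/2"
    then have "x \<in> strip" using ball_half_subset by (auto simp: dist_norm)
    then show "cmod (f x) \<le> M" using strip_max_principle[OF cont hol B M] by blast
  qed simp
  then show ?thesis by (simp add: fact_numeral power2_eq_square)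
qed

section \<open>The end spaces, their sum, and norm convergence\<close>

lemma vecs_ell_inf: "x \<in> vecs ell_inf \<longleftrightarrow> (\<exists>B. \<forall>n. cmod (x n) \<le> B)"
  by (auto simp: ell_inf_def bounded_iff)

lemma norm_ell_inf_ge: "x \<in> vecs ell_inf \<Longrightarrow> cmod (x n) \<le> vnorm ell_inf x"
  by (auto simp: ell_inf_def bounded_iff bdd_above_def intro!: cSUP_upper)

lemma norm_ell_inf_le: "(\<And>n. cmod (x n) \<le> e) \<Longrightarrow> vnorm ell_inf x \<le> e"
  by (auto simp: ell_inf_def intro!: cSUP_least)

lemma norm_ell_inf_nonneg: "x \<in> vecs ell_inf \<Longrightarrow> 0 \<le> vnorm ell_inf x"
  using norm_ell_inf_ge norm_ge_zero order_trans by blast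

lemma vecs_ell_1: "x \<in> vecs ell_1 \<longleftrightarrow> summable (\<lambda>n. cmod (x n))"
  by (simp add: ell_1_def)

lemma norm_ell_1_ge: "x \<in> vecs ell_1 \<Longrightarrow> (\<Sum>n<N. cmod (x n)) \<le> vnorm ell_1 x"
  by (auto simp: ell_1_def intro!: sum_le_suminf)

lemma norm_ell_1_le: "x \<in> vecs ell_1 \<Longrightarrow> (\<And>N. (\<Sum>n<N. cmod (x n)) \<le> e) \<Longrightarrow> vnorm ell_1 x \<le> e"
  by (auto simp: ell_1_def intro!: suminf_le_const)

lemma norm_ell_1_nonneg: "x \<in> vecs ell_1 \<Longrightarrow> 0 \<le> vnorm ell_1 x"
  using norm_ell_1_ge[of x 0] by simp

lemma cmod_le_sum: "cmod (x n) \<le> (\<Sum>k<Suc n. cmod (x k))"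
  by (simp add: sum_nonneg)

lemma norm_ell_1_ge_cmod: "x \<in> vecs ell_1 \<Longrightarrow> cmod (x n) \<le> vnorm ell_1 x"
  using norm_ell_1_ge[of x "Suc n"] cmod_le_sum[of x n] by linarith

abbreviation Sig :: "(nat \<Rightarrow> complex) nspace" where
  "Sig \<equiv> sum_space ell_inf ell_1"

lemma vecs_Sig: "vecs Sig = vecs ell_inf"
proof -
  have "x0 + x1 \<in> vecs ell_inf" if x0: "x0 \<in> vecs ell_inf" and x1: "x1 \<in> vecs ell_1" for x0 x1
  proof -
    obtain A where "\<And>n. cmod (x0 n) \<le> A" using x0 by (auto simp: vecs_ell_inf)
    moreover obtain B where "\<And>n. cmod (x1 n) \<le> B" using norm_ell_1_ge_cmod[OF x1] by blast
    ultimately have "cmod ((x0 + x1) n) \<le> A + B" for n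
      by (simp add: norm_triangle_mono)
    then show ?thesis by (auto simp: vecs_ell_inf)
  qed
  moreover have "\<exists>x0 x1. x = x0 + x1 \<and> x0 \<in> vecs ell_inf \<and> x1 \<in> vecs ell_1"
    if "x \<in> vecs ell_inf" for x
    by (rule exI[of _ x], rule exI[of _ 0]) (use that in \<open>simp add: vecs_ell_1\<close>)
  ultimately show ?thesis by (auto simp: sum_space_def)
qed

text \<open>The norm of \<open>ell_1\<close> dominates the sup norm, so no splitting does better
  than \<open>x + 0\<close>.\<close>

lemma norm_Sig:
  assumes x: "x \<in> vecs ell_inf"
  shows "vnorm Sig x = vnorm ell_inf x"
proof -
  let ?S = "{vnorm ell_inf x0 + vnorm ell_1 x1 | x0 x1.
               x0 \<in> vecs ell_inf \<and> x1 \<in> vecs ell_1 \<and> x = x0 + x1}"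
  have le: "vnorm ell_inf x \<le> s" if s: "s \<in> ?S" for s
  proof -
    obtain x0 x1 where *: "s = vnorm ell_inf x0 + vnorm ell_1 x1" "x0 \<in> vecs ell_inf"
      "x1 \<in> vecs ell_1" "x = x0 + x1" using s by blast
    show ?thesis unfolding *(1)
    proof (rule norm_ell_inf_le)
      show "cmod (x n) \<le> vnorm ell_inf x0 + vnorm ell_1 x1" for n
        using norm_ell_inf_ge[OF *(2)] norm_ell_1_ge_cmod[OF *(3)]
        by (simp add: *(4) norm_triangle_mono)
    qed
  qed
  have "vnorm ell_inf x + vnorm ell_1 0 \<in> ?S"
    by (rule CollectI, rule exI[of _ x], rule exI[of _ 0]) (use x in \<open>simp add: vecs_ell_1\<close>)
  then have "vnorm ell_inf x \<in> ?S" by (simp add: ell_1_def)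
  then have "Inf ?S = vnorm ell_inf x"
    by (intro cInf_eq_minimum le)
  then show ?thesis by (simp add: sum_space_def)
qed

text \<open>Convergence is recorded here and in \<open>sum_null\<close> by coordinate inequalities,
  because the \<open>SUP\<close> and the infinite sum behind \<open>vnorm\<close> are meaningful
  only on the respective spaces. Non-strict inequalities pass freely between the norm and all
  coordinates or partial sums.\<close>

definition unif_null :: "('b \<Rightarrow> nat \<Rightarrow> complex) \<Rightarrow> 'b filter \<Rightarrow> bool" where
  "unif_null f F \<longleftrightarrow> (\<forall>e>0. \<forall>\<^sub>F t in F. \<forall>n. cmod (f t n) \<le> e)"

definition sum_null :: "('b \<Rightarrow> nat \<Rightarrow> complex) \<Rightarrow> 'b filter \<Rightarrow> bool" where
  "sum_null f F \<longleftrightarrow> (\<forall>e>0. \<forall>\<^sub>F t in F. \<forall>N. (\<Sum>n<N. cmod (f t n)) \<le> e)"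

lemma tendsto_zero_iff_le:
  fixes h :: "'b \<Rightarrow> real"
  assumes "\<forall>\<^sub>F t in F. h t \<ge> 0"
  shows "(h \<longlongrightarrow> 0) F \<longleftrightarrow> (\<forall>e>0. \<forall>\<^sub>F t in F. h t \<le> e)"
proof
  assume "(h \<longlongrightarrow> 0) F"
  then show "\<forall>e>0. \<forall>\<^sub>F t in F. h t \<le> e"
    using order_tendstoD(2) less_imp_le eventually_mono by (metis (mono_tags, lifting))
next
  assume *: "\<forall>e>0. \<forall>\<^sub>F t in F. h t \<le> e"
  show "(h \<longlongrightarrow> 0) F"
  proof (rule tendstoI)
    fix e :: real assume "e > 0"
    then have "\<forall>\<^sub>F t in F. h t \<le> e/2" using * half_gt_zero by blast
    with assms show "\<forall>\<^sub>F t in F. dist (h t) 0 < e"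
      by eventually_elim (use \<open>e > 0\<close> in auto)
  qed
qed

lemma tendsto_ell_inf_iff:
  assumes ev: "\<forall>\<^sub>F t in F. f t \<in> vecs ell_inf"
  shows "((\<lambda>t. vnorm ell_inf (f t)) \<longlongrightarrow> 0) F \<longleftrightarrow> unif_null f F"
proof -
  have "\<forall>\<^sub>F t in F. vnorm ell_inf (f t) \<ge> 0"
    using ev by eventually_elim (rule norm_ell_inf_nonneg)
  moreover have "(\<forall>\<^sub>F t in F. vnorm ell_inf (f t) \<le> e) \<longleftrightarrow> (\<forall>\<^sub>F t in F. \<forall>n. cmod (f t n) \<le> e)" for e
    by (rule eventually_subst, use ev in eventually_elim)
      (use norm_ell_inf_le norm_ell_inf_ge order_trans in metis)
  ultimately show ?thesis by (simp add: tendsto_zero_iff_le unif_null_def)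
qed

lemma tendsto_Sig_iff:
  assumes ev: "\<forall>\<^sub>F t in F. f t \<in> vecs ell_inf"
  shows "((\<lambda>t. vnorm Sig (f t)) \<longlongrightarrow> 0) F \<longleftrightarrow> unif_null f F"
proof -
  have "((\<lambda>t. vnorm Sig (f t)) \<longlongrightarrow> 0) F \<longleftrightarrow> ((\<lambda>t. vnorm ell_inf (f t)) \<longlongrightarrow> 0) F"
    by (rule tendsto_cong, use ev in eventually_elim) (rule norm_Sig)
  then show ?thesis using tendsto_ell_inf_iff[OF ev] by simp
qed

lemma tendsto_ell_1_iff:
  assumes ev: "\<forall>\<^sub>F t in F. f t \<in> vecs ell_1"
  shows "((\<lambda>t. vnorm ell_1 (f t)) \<longlongrightarrow> 0) F \<longleftrightarrow> sum_null f F"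
proof -
  have "\<forall>\<^sub>F t in F. vnorm ell_1 (f t) \<ge> 0"
    using ev by eventually_elim (rule norm_ell_1_nonneg)
  moreover have "(\<forall>\<^sub>F t in F. vnorm ell_1 (f t) \<le> e) \<longleftrightarrow> (\<forall>\<^sub>F t in F. \<forall>N. (\<Sum>n<N. cmod (f t n)) \<le> e)" for e
    by (rule eventually_subst, use ev in eventually_elim)
      (use norm_ell_1_le norm_ell_1_ge order_trans in metis)
  ultimately show ?thesis by (simp add: tendsto_zero_iff_le sum_null_def)
qed

lemma unif_null_dominated:
  assumes "unif_null f F" and "C \<ge> 0" and "\<forall>\<^sub>F t in F. \<forall>n. cmod (g t n) \<le> C * cmod (f t n)"
  shows "unif_null g F"
  unfolding unif_null_def
proof (intro allI impI)
  fix e :: real assume "e > 0"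
  then have "\<forall>\<^sub>F t in F. \<forall>n. cmod (f t n) \<le> e / (C + 1)"
    using assms by (auto simp: unif_null_def)
  with assms(3) show "\<forall>\<^sub>F t in F. \<forall>n. cmod (g t n) \<le> e"
  proof eventually_elim
    case (elim t)
    show ?case
    proof
      fix n
      have "cmod (g t n) \<le> (C + 1) * cmod (f t n)"
        using elim(1) by (simp add: algebra_simps add_increasing)
      also have "\<dots> \<le> (C + 1) * (e / (C + 1))"
        using elim(2) assms(2) by (intro mult_left_mono) auto
      finally show "cmod (g t n) \<le> e" using assms(2) by simp
    qed
  qed
qed

lemma sum_null_dominated:
  assumes "sum_null f F" and "C \<ge> 0" and "\<forall>\<^sub>F t in F. \<forall>n. cmod (g t n) \<le> C * cmod (f t n)"
  shows "sum_null g F"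
  unfolding sum_null_def
proof (intro allI impI)
  fix e :: real assume "e > 0"
  then have "\<forall>\<^sub>F t in F. \<forall>N. (\<Sum>n<N. cmod (f t n)) \<le> e / (C + 1)"
    using assms by (auto simp: sum_null_def)
  with assms(3) show "\<forall>\<^sub>F t in F. \<forall>N. (\<Sum>n<N. cmod (g t n)) \<le> e"
  proof eventually_elim
    case (elim t)
    show ?case
    proof
      fix N
      have "(\<Sum>n<N. cmod (g t n)) \<le> (\<Sum>n<N. C * cmod (f t n))"
        using elim(1) by (intro sum_mono) auto
      also have "\<dots> = C * (\<Sum>n<N. cmod (f t n))" by (simp add: sum_distrib_left)
      also have "\<dots> \<le> (C + 1) * (\<Sum>n<N. cmod (f t n))"
        by (intro mult_right_mono sum_nonneg) auto
      also have "\<dots> \<le> (C + 1) * (e / (C + 1))"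
        using elim(2) assms(2) by (intro mult_left_mono) auto
      finally show "(\<Sum>n<N. cmod (g t n)) \<le> e" using assms(2) by simp
    qed
  qed
qed

lemma unif_null_add:
  assumes "unif_null f F" "unif_null g F"
  shows "unif_null (\<lambda>t. f t + g t) F"
  unfolding unif_null_def
proof (intro allI impI)
  fix e :: real assume "e > 0"
  then have "\<forall>\<^sub>F t in F. \<forall>n. cmod (f t n) \<le> e/2" "\<forall>\<^sub>F t in F. \<forall>n. cmod (g t n) \<le> e/2"
    using assms half_gt_zero unfolding unif_null_def by blast+
  then show "\<forall>\<^sub>F t in F. \<forall>n. cmod ((f t + g t) n) \<le> e"
    by eventually_elim (metis field_sum_of_halves norm_triangle_mono plus_fun_apply)
qed

lemma sum_null_add:
  assumes "sum_null f F" "sum_null g F"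
  shows "sum_null (\<lambda>t. f t + g t) F"
  unfolding sum_null_def
proof (intro allI impI)
  fix e :: real assume "e > 0"
  then have "\<forall>\<^sub>F t in F. \<forall>N. (\<Sum>n<N. cmod (f t n)) \<le> e/2"
    "\<forall>\<^sub>F t in F. \<forall>N. (\<Sum>n<N. cmod (g t n)) \<le> e/2"
    using assms half_gt_zero unfolding sum_null_def by blast+
  then show "\<forall>\<^sub>F t in F. \<forall>N. (\<Sum>n<N. cmod ((f t + g t) n)) \<le> e"
  proof eventually_elim
    case (elim t)
    show ?case
    proof
      fix N
      have "(\<Sum>n<N. cmod ((f t + g t) n)) \<le> (\<Sum>n<N. cmod (f t n)) + (\<Sum>n<N. cmod (g t n))"
        unfolding sum.distrib[symmetric] by (intro sum_mono) (simp add: norm_triangle_ineq)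
      then show "(\<Sum>n<N. cmod ((f t + g t) n)) \<le> e" using elim by (smt (verit) field_sum_of_halves)
    qed
  qed
qed

section \<open>Vector-valued derivatives and holomorphic coordinates\<close>

text \<open>Evaluation at a coordinate is bounded by the sup norm, so a vector derivative is
  determined by the scalar ones. This makes the definite description in \<open>vderiv\<close>
  meaningful.\<close>

lemma has_vderiv_unique:
  assumes "has_vderiv Sig F D z" and F: "\<And>w. w \<in> U \<Longrightarrow> F w \<in> vecs ell_inf" and U: "open U" "z \<in> U"
  shows "((\<lambda>w. F w n) has_field_derivative D n) (at z)"
proof -
  have D: "D \<in> vecs ell_inf" using assms(1) by (simp add: has_vderiv_def vecs_Sig)
  define Q where "Q w = inverse (w - z) *\<^sub>C (F w - F z) - D" for w
  have q: "Q w n = (F w n - F z n) / (w - z) - D n" for w n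
    by (simp add: Q_def scaleC_fun_def scaleC_complex_def field_simps)
  have evU: "\<forall>\<^sub>F w in at z. w \<in> U" using U by (simp add: eventually_at_in_open')
  have "\<forall>\<^sub>F w in at z. Q w \<in> vecs ell_inf"
    using evU
  proof eventually_elim
    case (elim w)
    obtain A B C where "\<And>n. cmod (F w n) \<le> A" "\<And>n. cmod (F z n) \<le> B" "\<And>n. cmod (D n) \<le> C"
      using F[OF elim] F[OF U(2)] D by (auto simp: vecs_ell_inf)
    then have "cmod (Q w n) \<le> (A + B) / cmod (w - z) + C" for n
      unfolding q norm_divide
      by (intro order_trans[OF norm_triangle_ineq4] add_mono)
        (auto intro!: divide_right_mono order_trans[OF norm_triangle_ineq4] add_mono simp: norm_divide)
    then show ?case unfolding vecs_ell_inf by blast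
  qed
  then have "unif_null Q (at z)"
    using assms(1) tendsto_Sig_iff[of Q] by (simp add: has_vderiv_def Q_def[abs_def])
  then have "\<forall>e>0. \<forall>\<^sub>F w in at z. cmod (Q w n) \<le> e"
    unfolding unif_null_def by (auto elim!: eventually_mono)
  moreover have "\<forall>\<^sub>F w in at z. 0 \<le> cmod (Q w n)" by (rule always_eventually) simp
  ultimately have "((\<lambda>w. cmod (Q w n)) \<longlongrightarrow> 0) (at z)"
    using tendsto_zero_iff_le[of "\<lambda>w. cmod (Q w n)" "at z"] by meson
  then have "((\<lambda>w. Q w n) \<longlongrightarrow> 0) (at z)"
    by (rule tendsto_norm_zero_cancel)
  then show ?thesis
    by (simp add: q has_field_derivative_iff LIM_zero_iff)
qed

text \<open>Cauchy's estimate for the second derivative makes the difference quotients of the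
  coordinates converge uniformly.\<close>

lemma has_vderiv_coordinatewise:
  assumes r: "r > 0" and hol: "\<And>n. (\<lambda>w. F w n) holomorphic_on ball z r"
    and B: "\<And>w n. w \<in> ball z r \<Longrightarrow> cmod (F w n) \<le> B"
  shows "has_vderiv Sig F (\<lambda>n. deriv (\<lambda>w. F w n) z) z"
proof -
  let ?D = "\<lambda>n. deriv (\<lambda>w. F w n) z"
  let ?q = "\<lambda>w. inverse (w - z) *\<^sub>C (F w - F z) - ?D"
  have q: "?q w n = (F w n - F z n) / (w - z) - ?D n" for w n
    by (simp add: scaleC_fun_def scaleC_complex_def field_simps)
  have deriv_bd: "cmod ((deriv ^^ k) (\<lambda>w. F w n) w) \<le> fact k * B / (r/4)^k"
    if w: "w \<in> ball z (r/2)" for w n k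
  proof (rule Cauchy_inequality)
    have "cball w (r/4) \<subseteq> ball z r"
    proof
      fix v assume "v \<in> cball w (r/4)"
      then show "v \<in> ball z r" using w dist_triangle[of z v w] r by auto
    qed
    then have "(\<lambda>w. F w n) holomorphic_on cball w (r/4)"
      by (rule holomorphic_on_subset[OF hol])
    then show "(\<lambda>w. F w n) holomorphic_on ball w (r/4)"
      "continuous_on (cball w (r/4)) (\<lambda>w. F w n)"
      by (auto intro: holomorphic_on_subset holomorphic_on_imp_continuous_on)
    show "cmod (F v n) \<le> B" if "cmod (w - v) = r/4" for v
      using \<open>cball w (r/4) \<subseteq> ball z r\<close> that by (intro B) (auto simp: dist_norm)
  qed (use r in auto)
  define K where "K = fact 2 * B / (r/4)^2"
  have B0: "B \<ge> 0" using B[of z 0] r norm_ge_zero order_trans by (metis centre_in_ball)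
  have K0: "K \<ge> 0" using B0 by (simp add: K_def)
  have bd: "cmod (?q w n) \<le> K * cmod (w - z)" if w: "w \<in> ball z (r/2)" "w \<noteq> z" for w n
  proof -
    have "cmod (((deriv ^^ 0) (\<lambda>w. F w n)) w - (\<Sum>i\<le>1. (deriv ^^ i) (\<lambda>w. F w n) z * (w-z) ^ i / (fact i)))
       \<le> K * cmod (w - z) ^ (Suc 1) / fact 1"
    proof (rule complex_Taylor[where S = "ball z (r/2)" and f = "\<lambda>i. (deriv ^^ i) (\<lambda>w. F w n)" and n = 1])
      show "((deriv ^^ i) (\<lambda>w. F w n) has_field_derivative (deriv ^^ Suc i) (\<lambda>w. F w n) x)
             (at x within ball z (r/2))" if "x \<in> ball z (r/2)" for i x
        by (rule has_field_derivative_at_within, rule has_field_derivative_higher_deriv[OF hol])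
          (use that r in auto)
      show "cmod ((deriv ^^ Suc 1) (\<lambda>w. F w n) x) \<le> K" if "x \<in> ball z (r/2)" for x
        using deriv_bd[OF that, of 2 n] by (simp add: K_def numeral_2_eq_2)
    qed (use w r in auto)
    then have *: "cmod (F w n - F z n - ?D n * (w - z)) \<le> K * cmod (w - z) ^ 2"
      by (simp add: algebra_simps power2_eq_square)
    have "?q w n = (F w n - F z n - ?D n * (w - z)) / (w - z)"
      unfolding q using w(2) by (simp add: field_simps)
    then have "cmod (?q w n) = cmod (F w n - F z n - ?D n * (w - z)) / cmod (w - z)"
      by (simp add: norm_divide)
    also have "\<dots> \<le> K * cmod (w - z) ^ 2 / cmod (w - z)"
      using * by (intro divide_right_mono) auto
    also have "\<dots> = K * cmod (w - z)" by (simp add: power2_eq_square)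
    finally show ?thesis .
  qed
  have ev: "\<forall>\<^sub>F w in at z. w \<in> ball z (r/2) \<and> w \<noteq> z"
    using r eventually_at_in_open[of "ball z (r/2)" z] by auto
  have D: "?D \<in> vecs ell_inf"
    using deriv_bd[of z 1] r by (auto simp: vecs_ell_inf)
  have "\<forall>\<^sub>F w in at z. ?q w \<in> vecs ell_inf"
    using ev by eventually_elim (use bd vecs_ell_inf in blast)
  moreover have "unif_null ?q (at z)"
    unfolding unif_null_def
  proof (intro allI impI)
    fix e :: real assume e: "e > 0"
    have "((\<lambda>w. K * cmod (w - z)) \<longlongrightarrow> K * cmod (z - z)) (at z)" by (intro tendsto_intros)
    then have "\<forall>\<^sub>F w in at z. K * cmod (w - z) < e"
      using e order_tendstoD(2) by fastforce
    with ev show "\<forall>\<^sub>F w in at z. \<forall>n. cmod (?q w n) \<le> e"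
      by eventually_elim (use bd in \<open>meson less_imp_le order_trans\<close>)
  qed
  ultimately show ?thesis
    using tendsto_Sig_iff[of ?q] D by (simp add: has_vderiv_def vecs_Sig)
qed

subsection \<open>The Calderon space\<close>

lemma ell_inf_diff: "x \<in> vecs ell_inf \<Longrightarrow> y \<in> vecs ell_inf \<Longrightarrow> x - y \<in> vecs ell_inf"
proof -
  assume x: "x \<in> vecs ell_inf" and y: "y \<in> vecs ell_inf"
  have "cmod ((x - y) n) \<le> vnorm ell_inf x + vnorm ell_inf y" for n
    using norm_ell_inf_ge[OF x, of n] norm_ell_inf_ge[OF y, of n] norm_triangle_ineq4[of "x n" "y n"]
    by simp
  then show ?thesis unfolding vecs_ell_inf by blast
qed

lemma ell_1_diff: "x \<in> vecs ell_1 \<Longrightarrow> y \<in> vecs ell_1 \<Longrightarrow> x - y \<in> vecs ell_1"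
  unfolding vecs_ell_1
  by (rule summable_comparison_test'[where g = "\<lambda>n. cmod (x n) + cmod (y n)" and N = 0])
    (auto intro: summable_add norm_triangle_ineq4)

lemma unif_null_compose:
  assumes "unif_null f G" "filterlim g G F" shows "unif_null (\<lambda>t. f (g t)) F"
  unfolding unif_null_def
proof (intro allI impI)
  fix e :: real assume "e > 0"
  then have "\<forall>\<^sub>F t in G. \<forall>n. cmod (f t n) \<le> e" using assms(1) by (auto simp: unif_null_def)
  then show "\<forall>\<^sub>F t in F. \<forall>n. cmod (f (g t) n) \<le> e" using assms(2) by (auto simp: filterlim_iff)
qed

lemma vderiv_coordinatewise:
  assumes r: "r > 0" and hol: "\<And>n. (\<lambda>w. F w n) holomorphic_on ball z r"
    and B: "\<And>w n. w \<in> ball z r \<Longrightarrow> cmod (F w n) \<le> B"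
  shows "vderiv Sig F z = (\<lambda>n. deriv (\<lambda>w. F w n) z)"
  unfolding vderiv_def
proof (rule the_equality)
  show "has_vderiv Sig F (\<lambda>n. deriv (\<lambda>w. F w n) z) z"
    by (rule has_vderiv_coordinatewise[OF r hol B])
  fix D assume D: "has_vderiv Sig F D z"
  show "D = (\<lambda>n. deriv (\<lambda>w. F w n) z)"
  proof
    fix n
    have "((\<lambda>w. F w n) has_field_derivative D n) (at z)"
    proof (rule has_vderiv_unique[OF D])
      show "F w \<in> vecs ell_inf" if "w \<in> ball z r" for w
        using B[OF that] unfolding vecs_ell_inf by blast
    qed (use r in auto)
    then show "D n = deriv (\<lambda>w. F w n) z" by (simp add: DERIV_imp_deriv)
  qed
qed

text \<open>Each differentiation needs a bound uniform in the coordinates, which Cauchy's inequality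
  restores on a smaller disc. The induction hypothesis identifies the iterated \<open>vderiv\<close>
  only on \<open>U\<close>, hence the comparison of germs at \<open>z\<close>.\<close>

lemma higher_vderiv_coordinatewise:
  assumes U: "open U" and hol: "\<And>n. (\<lambda>w. F w n) holomorphic_on U"
    and B: "\<And>w n. w \<in> U \<Longrightarrow> cmod (F w n) \<le> B"
  shows "z \<in> U \<Longrightarrow> (vderiv Sig ^^ k) F z = (\<lambda>n. (deriv ^^ k) (\<lambda>w. F w n) z)"
proof (induction k arbitrary: z)
  case 0 show ?case by simp
next
  case (Suc k)
  let ?G = "(vderiv Sig ^^ k) F"
  obtain R where R: "R > 0" "cball z R \<subseteq> U" using U Suc.prems open_contains_cball by blast
  have sub: "ball z (R/2) \<subseteq> U" using R by (auto simp: subset_iff)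
  have holk: "(deriv ^^ k) (\<lambda>w. F w n) holomorphic_on U" for n
    using holomorphic_higher_deriv hol U by blast
  have eq: "?G w n = (deriv ^^ k) (\<lambda>w. F w n) w" if "w \<in> U" for w n
    using Suc.IH[OF that] by simp
  have "vderiv Sig ?G z = (\<lambda>n. deriv (\<lambda>w. ?G w n) z)"
  proof (rule vderiv_coordinatewise)
    show "R/2 > 0" using R by simp
    show "(\<lambda>w. ?G w n) holomorphic_on ball z (R/2)" for n
      using holomorphic_on_subset[OF holk sub] by (rule holomorphic_transform) (use eq sub in auto)
    fix w n assume w: "w \<in> ball z (R/2)"
    have cb: "cball w (R/2) \<subseteq> U"
    proof
      fix v assume "v \<in> cball w (R/2)"
      then have "v \<in> cball z R" using w dist_triangle[of z v w] by auto
      then show "v \<in> U" using R by auto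
    qed
    have "cmod ((deriv ^^ k) (\<lambda>w. F w n) w) \<le> fact k * B / (R/2) ^ k"
    proof (rule Cauchy_inequality)
      have "(\<lambda>w. F w n) holomorphic_on cball w (R/2)" using holomorphic_on_subset[OF hol cb] .
      then show "(\<lambda>w. F w n) holomorphic_on ball w (R/2)" "continuous_on (cball w (R/2)) (\<lambda>w. F w n)"
        by (auto intro: holomorphic_on_subset holomorphic_on_imp_continuous_on)
      show "cmod (F v n) \<le> B" if "cmod (w - v) = R/2" for v
        using cb that by (intro B) (auto simp: dist_norm)
    qed (use R in auto)
    then show "cmod (?G w n) \<le> fact k * B / (R/2) ^ k"
      using eq w sub by auto
  qed
  moreover have "deriv (\<lambda>w. ?G w n) z = deriv ((deriv ^^ k) (\<lambda>w. F w n)) z" for n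
  proof (rule deriv_cong_ev)
    show "\<forall>\<^sub>F w in nhds z. ?G w n = (deriv ^^ k) (\<lambda>w. F w n) w"
      using eventually_nhds_in_open[OF U Suc.prems] by eventually_elim (rule eq)
  qed simp
  ultimately show ?case by simp
qed

text \<open>As \<open>Sig\<close> carries the sup norm, differentiability into it amounts to
  holomorphic coordinates with a uniform bound, and continuity along the left line is part of
  continuity on the strip. On the right line, convergence in the finer norm remains a separate
  condition.\<close>

lemma Calderon_iff:
  "F \<in> vecs Calderon \<longleftrightarrow>
     (\<forall>z. z \<notin> strip \<longrightarrow> F z = 0) \<and> (\<exists>B. \<forall>z n. cmod (F z n) \<le> B) \<and>
     (\<forall>n. (\<lambda>z. F z n) holomorphic_on open_strip) \<and>
     (\<forall>s\<in>strip. unif_null (\<lambda>z. F z - F s) (at s within strip)) \<and>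
     unif_null (\<lambda>t. F (Complex 0 t)) at_infinity \<and>
     (\<forall>t. F (Complex 1 t) \<in> vecs ell_1) \<and>
     (\<forall>s. sum_null (\<lambda>t. F (Complex 1 t) - F (Complex 1 s)) (at s)) \<and>
     sum_null (\<lambda>t. F (Complex 1 t)) at_infinity" (is "?L \<longleftrightarrow> ?R")
proof
  assume ?L
  then have ci: "continuous_into Sig strip F"
    and bd: "\<exists>B. \<forall>z\<in>strip. vnorm Sig (F z) \<le> B"
    and hd: "\<And>z. z \<in> open_strip \<Longrightarrow> \<exists>D. has_vderiv Sig F D z"
    and b0: "boundary_ok ell_inf (\<lambda>t. F (Complex 0 t))"
    and b1: "boundary_ok ell_1 (\<lambda>t. F (Complex 1 t))"
    and off: "\<And>z. z \<notin> strip \<Longrightarrow> F z = 0"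
    by (simp_all add: Calderon_def calderon_def)
  have Fz: "F z \<in> vecs ell_inf" for z
  proof (cases "z \<in> strip")
    case True then show ?thesis using ci by (auto simp: continuous_into_def vecs_Sig)
  next
    case False then show ?thesis using off by (auto simp: vecs_ell_inf)
  qed
  have F0: "F (Complex 0 t) \<in> vecs ell_inf" and F1: "F (Complex 1 t) \<in> vecs ell_1" for t
    using b0 b1 by (auto simp: boundary_ok_def continuous_into_def)
  obtain B where B: "\<And>z. z \<in> strip \<Longrightarrow> vnorm Sig (F z) \<le> B" using bd by blast
  have "cmod (F z n) \<le> max B 0" for z n
  proof (cases "z \<in> strip")
    case True then show ?thesis
      using norm_ell_inf_ge[OF Fz, of z n] B[OF True] norm_Sig[OF Fz, of z] by linarith
  qed (simp add: off)
  moreover have "(\<lambda>z. F z n) holomorphic_on open_strip" for n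
    unfolding holomorphic_on_open[OF open_open_strip]
    using hd has_vderiv_unique[OF _ Fz open_UNIV] by (meson UNIV_I)
  moreover have "unif_null (\<lambda>z. F z - F s) (at s within strip)" if "s \<in> strip" for s
    using ci that tendsto_Sig_iff[of "\<lambda>z. F z - F s"] Fz ell_inf_diff
    by (auto simp: continuous_into_def)
  moreover have "unif_null (\<lambda>t. F (Complex 0 t)) at_infinity"
    using b0 tendsto_ell_inf_iff[of "\<lambda>t. F (Complex 0 t)"] F0 by (simp add: boundary_ok_def)
  moreover have "sum_null (\<lambda>t. F (Complex 1 t)) at_infinity"
    using b1 tendsto_ell_1_iff[of "\<lambda>t. F (Complex 1 t)"] F1 by (simp add: boundary_ok_def)
  moreover have "sum_null (\<lambda>t. F (Complex 1 t) - F (Complex 1 s)) (at s)" for s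
  proof -
    have "((\<lambda>t. vnorm ell_1 (F (Complex 1 t) - F (Complex 1 s))) \<longlongrightarrow> 0) (at s)"
      using b1 by (simp add: boundary_ok_def continuous_into_def)
    then show ?thesis
      using tendsto_ell_1_iff[of "\<lambda>t. F (Complex 1 t) - F (Complex 1 s)" "at s"] F1 ell_1_diff by simp
  qed
  ultimately show ?R using off F1 by blast
next
  assume R: ?R
  then obtain B where B: "\<And>z n. cmod (F z n) \<le> B" by blast
  from R have off: "\<And>z. z \<notin> strip \<Longrightarrow> F z = 0"
    and hol: "\<And>n. (\<lambda>z. F z n) holomorphic_on open_strip"
    and un: "\<And>s. s \<in> strip \<Longrightarrow> unif_null (\<lambda>z. F z - F s) (at s within strip)"
    and b0: "unif_null (\<lambda>t. F (Complex 0 t)) at_infinity"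
    and F1: "\<And>t. F (Complex 1 t) \<in> vecs ell_1"
    and c1: "\<And>s. sum_null (\<lambda>t. F (Complex 1 t) - F (Complex 1 s)) (at s)"
    and b1: "sum_null (\<lambda>t. F (Complex 1 t)) at_infinity"
    by blast+
  have Fz: "F z \<in> vecs ell_inf" for z using B unfolding vecs_ell_inf by blast
  have "continuous_into Sig strip F"
    using un tendsto_Sig_iff[of "\<lambda>z. F z - F s" for s] Fz ell_inf_diff
    by (auto simp: continuous_into_def vecs_Sig)
  moreover have "vnorm Sig (F z) \<le> B" for z
    using norm_Sig[OF Fz] norm_ell_inf_le[OF B] by simp
  moreover have "\<exists>D. has_vderiv Sig F D z" if z: "z \<in> open_strip" for z
  proof -
    obtain r where "r > 0" "ball z r \<subseteq> open_strip"
      using z open_open_strip open_contains_ball by blast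
    then have "has_vderiv Sig F (\<lambda>n. deriv (\<lambda>w. F w n) z) z"
      by (intro has_vderiv_coordinatewise[where r = r and B = B] B holomorphic_on_subset[OF hol])
    then show ?thesis by blast
  qed
  moreover have "unif_null (\<lambda>t. F (Complex 0 t) - F (Complex 0 s)) (at s)" for s
  proof (rule unif_null_compose[where f = "\<lambda>z. F z - F (Complex 0 s)"])
    show "unif_null (\<lambda>z. F z - F (Complex 0 s)) (at (Complex 0 s) within strip)"
      by (rule un) (simp add: strip_def)
    have "((\<lambda>t. Complex 0 t) \<longlongrightarrow> Complex 0 s) (at s)"
      by (intro tendsto_intros)
    then show "filterlim (\<lambda>t. Complex 0 t) (at (Complex 0 s) within strip) (at s)"
      unfolding filterlim_at
      by (auto simp: strip_def eventually_at_filter)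
  qed
  then have "boundary_ok ell_inf (\<lambda>t. F (Complex 0 t))"
    using b0 tendsto_ell_inf_iff[of "\<lambda>t. F (Complex 0 t)"]
      tendsto_ell_inf_iff[of "\<lambda>t. F (Complex 0 t) - F (Complex 0 s)" for s] Fz ell_inf_diff
    by (auto simp: boundary_ok_def continuous_into_def)
  moreover have "boundary_ok ell_1 (\<lambda>t. F (Complex 1 t))"
    using b1 c1 tendsto_ell_1_iff[of "\<lambda>t. F (Complex 1 t)"]
      tendsto_ell_1_iff[of "\<lambda>t. F (Complex 1 t) - F (Complex 1 s)" for s] F1 ell_1_diff
    by (auto simp: boundary_ok_def continuous_into_def)
  ultimately show ?L using off
    by (auto simp: Calderon_def calderon_def)
qed

lemma Calderon_bounded: "F \<in> vecs Calderon \<Longrightarrow> \<exists>B. \<forall>z n. cmod (F z n) \<le> B"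
  by (simp add: Calderon_iff)

lemma Calderon_holomorphic: "F \<in> vecs Calderon \<Longrightarrow> (\<lambda>z. F z n) holomorphic_on open_strip"
  by (simp add: Calderon_iff)

lemma Calderon_continuous:
  assumes "F \<in> vecs Calderon" shows "continuous_on strip (\<lambda>z. F z n)"
  unfolding continuous_on_def
proof
  fix s assume "s \<in> strip"
  then have "unif_null (\<lambda>z. F z - F s) (at s within strip)" using assms by (simp add: Calderon_iff)
  then have *: "\<forall>e>0. \<forall>\<^sub>F z in at s within strip. cmod (F z n - F s n) \<le> e"
    unfolding unif_null_def by (auto elim!: eventually_mono)
  have "((\<lambda>z. cmod (F z n - F s n)) \<longlongrightarrow> 0) (at s within strip)"
    by (rule iffD2[OF tendsto_zero_iff_le *]) simp
  then show "((\<lambda>z. F z n) \<longlongrightarrow> F s n) (at s within strip)"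
    by (rule LIM_zero_cancel[OF tendsto_norm_zero_cancel])
qed

section \<open>Multipliers, truncations and sums\<close>

definition restr :: "nat set \<Rightarrow> (nat \<Rightarrow> complex) \<Rightarrow> nat \<Rightarrow> complex" where
  "restr A x = (\<lambda>n. if n \<in> A then x n else 0)"

lemma ell_1_dominated:
  assumes "x \<in> vecs ell_1" "\<And>n. cmod (y n) \<le> C * cmod (x n)"
  shows "y \<in> vecs ell_1"
  using assms unfolding vecs_ell_1
  by (intro summable_comparison_test'[where g = "\<lambda>n. C * cmod (x n)" and N = 0 and f = "\<lambda>n. cmod (y n)"])
    (auto intro: summable_mult)

text \<open>Multiplication by a bounded sequence acts on both end spaces at once. Constant sequences
  give scalars, indicator sequences the truncations.\<close>

lemma Calderon_diagonal:
  assumes F: "F \<in> vecs Calderon" and c: "\<And>n. cmod (c n) \<le> C"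
  shows "(\<lambda>z n. c n * F z n) \<in> vecs Calderon"
proof -
  have C0: "C \<ge> 0" using c norm_ge_zero order_trans by blast
  have dom: "cmod (c n * x) \<le> C * cmod x" for n x
    by (simp add: norm_mult mult_right_mono c)
  have dom': "cmod (c n * x - c n * y) \<le> C * cmod (x - y)" for n x y
    using dom[of n "x - y"] by (simp add: right_diff_distrib)
  obtain B where B: "\<And>z n. cmod (F z n) \<le> B" using Calderon_bounded[OF F] by blast
  have "cmod (c n * F z n) \<le> C * B" for z n
    using order_trans[OF dom mult_left_mono[OF B C0]] .
  then have "\<exists>B. \<forall>z n. cmod (c n * F z n) \<le> B" by blast
  moreover have "(\<lambda>z. c n * F z n) holomorphic_on open_strip" for n
    by (intro holomorphic_intros Calderon_holomorphic F)
  moreover have "unif_null (\<lambda>z. (\<lambda>n. c n * F z n) - (\<lambda>n. c n * F s n)) (at s within strip)"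
    if "s \<in> strip" for s
    by (rule unif_null_dominated[where f = "\<lambda>z. F z - F s" and C = C])
      (use F that C0 dom' in \<open>auto simp: Calderon_iff\<close>)
  moreover have "unif_null (\<lambda>t n. c n * F (Complex 0 t) n) at_infinity"
    by (rule unif_null_dominated[where f = "\<lambda>t. F (Complex 0 t)" and C = C])
      (use F C0 dom in \<open>auto simp: Calderon_iff\<close>)
  moreover have "sum_null (\<lambda>t n. c n * F (Complex 1 t) n) at_infinity"
    by (rule sum_null_dominated[where f = "\<lambda>t. F (Complex 1 t)" and C = C])
      (use F C0 dom in \<open>auto simp: Calderon_iff\<close>)
  moreover have "sum_null (\<lambda>t. (\<lambda>n. c n * F (Complex 1 t) n) - (\<lambda>n. c n * F (Complex 1 s) n)) (at s)" for s
    by (rule sum_null_dominated[where f = "\<lambda>t. F (Complex 1 t) - F (Complex 1 s)" and C = C])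
      (use F C0 dom' in \<open>auto simp: Calderon_iff\<close>)
  moreover have "(\<lambda>n. c n * F (Complex 1 t) n) \<in> vecs ell_1" for t
    by (rule ell_1_dominated[where x = "F (Complex 1 t)" and C = C])
      (use F dom in \<open>auto simp: Calderon_iff\<close>)
  moreover have "(\<lambda>n. c n * F z n) = 0" if "z \<notin> strip" for z
    using F that by (simp add: Calderon_iff fun_eq_iff)
  ultimately show ?thesis unfolding Calderon_iff by blast
qed

lemma restr_eq_mult: "restr A x = (\<lambda>n. of_bool (n \<in> A) * x n)"
  by (auto simp: restr_def)

lemma Calderon_restr: "F \<in> vecs Calderon \<Longrightarrow> (\<lambda>z. restr A (F z)) \<in> vecs Calderon"
  unfolding restr_eq_mult by (rule Calderon_diagonal[where C = 1]) auto

lemma scaleC_coord: "(c *\<^sub>C F) z n = c * F z n" for F :: "complex \<Rightarrow> nat \<Rightarrow> complex"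
  by (simp add: scaleC_fun_def scaleC_complex_def)

lemma Calderon_scale: "F \<in> vecs Calderon \<Longrightarrow> c *\<^sub>C F \<in> vecs Calderon"
  using Calderon_diagonal[of F "\<lambda>_. c" "cmod c"] by (simp add: scaleC_fun_def scaleC_complex_def)

lemma Calderon_add:
  assumes F: "F \<in> vecs Calderon" and G: "G \<in> vecs Calderon"
  shows "F + G \<in> vecs Calderon"
proof -
  obtain A where A: "\<And>z n. cmod (F z n) \<le> A" using Calderon_bounded[OF F] by blast
  obtain B where B: "\<And>z n. cmod (G z n) \<le> B" using Calderon_bounded[OF G] by blast
  have "cmod ((F + G) z n) \<le> A + B" for z n
    using norm_triangle_mono[OF A B] by simp
  then have "\<exists>B. \<forall>z n. cmod ((F + G) z n) \<le> B" by blast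
  moreover have "(\<lambda>z. (F + G) z n) holomorphic_on open_strip" for n
    unfolding plus_fun_apply by (intro holomorphic_intros Calderon_holomorphic F G)
  moreover have "unif_null (\<lambda>z. (F + G) z - (F + G) s) (at s within strip)"
    if "s \<in> strip" for s
    using unif_null_add[of "\<lambda>z. F z - F s" _ "\<lambda>z. G z - G s"] F G that
    by (simp add: Calderon_iff add_diff_add[symmetric] algebra_simps)
  moreover have "unif_null (\<lambda>t. (F + G) (Complex 0 t)) at_infinity"
    unfolding plus_fun_apply[of F G] by (rule unif_null_add) (use F G in \<open>auto simp: Calderon_iff\<close>)
  moreover have "sum_null (\<lambda>t. (F + G) (Complex 1 t)) at_infinity"
    unfolding plus_fun_apply[of F G] by (rule sum_null_add) (use F G in \<open>auto simp: Calderon_iff\<close>)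
  moreover have "sum_null (\<lambda>t. (F + G) (Complex 1 t) - (F + G) (Complex 1 s)) (at s)" for s
    using sum_null_add[of "\<lambda>t. F (Complex 1 t) - F (Complex 1 s)" _ "\<lambda>t. G (Complex 1 t) - G (Complex 1 s)"] F G
    by (simp add: Calderon_iff algebra_simps)
  moreover have "(F + G) (Complex 1 t) \<in> vecs ell_1" for t
    unfolding vecs_ell_1
    by (rule summable_comparison_test'[where g = "\<lambda>n. cmod (F (Complex 1 t) n) + cmod (G (Complex 1 t) n)" and N = 0])
      (use F G in \<open>auto simp: Calderon_iff vecs_ell_1 intro!: summable_add norm_triangle_ineq\<close>)
  moreover have "(F + G) z = 0" if "z \<notin> strip" for z
    using F G that by (simp add: Calderon_iff fun_eq_iff)
  ultimately show ?thesis unfolding Calderon_iff by blast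
qed

lemma Calderon_zero: "0 \<in> vecs Calderon"
  by (auto simp: Calderon_iff vecs_ell_1 unif_null_def sum_null_def)

section \<open>Uniformity along the boundary lines and the norm\<close>

text \<open>Decay takes care of the outside of a compact interval, finitely many local indices cover
  the interval, and monotonicity lets their maximum serve everywhere. The index will be a bound in
  one application and the start of a tail in two others.\<close>

lemma real_eventually_uniform:
  fixes P :: "nat \<Rightarrow> real \<Rightarrow> bool"
  assumes loc: "\<And>s. \<exists>N. \<forall>\<^sub>F t in nhds s. P N t" and inf: "\<exists>N. \<forall>\<^sub>F t in at_infinity. P N t"
    and mono: "\<And>N M t. P N t \<Longrightarrow> N \<le> M \<Longrightarrow> P M t"
  shows "\<exists>N. \<forall>t. P N t"
proof -
  obtain N0 R where R: "\<And>t. \<bar>t\<bar> \<ge> R \<Longrightarrow> P N0 t"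
    using inf by (auto simp: eventually_at_infinity)
  obtain N U where NU: "\<And>s. open (U s)" "\<And>s. s \<in> U s" "\<And>s t. t \<in> U s \<Longrightarrow> P (N s) t"
    using loc unfolding eventually_nhds by metis
  have "compact {-R..R}" by simp
  moreover have "{-R..R} \<subseteq> (\<Union>s\<in>{-R..R}. U s)" using NU by auto
  ultimately obtain T where T: "finite T" "{-R..R} \<subseteq> (\<Union>s\<in>T. U s)"
    using NU(1) by (metis compactE_image)
  define M where "M = Max (insert N0 (N ` T))"
  have M: "N0 \<le> M" "\<And>s. s \<in> T \<Longrightarrow> N s \<le> M"
    using T(1) by (auto simp: M_def)
  have "P M t" for t
  proof (cases "\<bar>t\<bar> \<ge> R")
    case True then show ?thesis using R mono M by blast
  next
    case False
    then have "t \<in> {-R..R}" by auto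
    then obtain s where "s \<in> T" "t \<in> U s" using T by blast
    then show ?thesis using NU(3) mono M by blast
  qed
  then show ?thesis by blast
qed

text \<open>The \<open>SUP\<close> over the right line in the Calderon norm controls its terms only
  if the set is bounded above. This is not among the defining conditions; it comes from continuity
  and decay in the norm of \<open>ell_1\<close>.\<close>

lemma Calderon_bounded_sums:
  assumes F: "F \<in> vecs Calderon"
  shows "\<exists>C. \<forall>t N. (\<Sum>n<N. cmod (F (Complex 1 t) n)) \<le> C"
proof -
  have "\<exists>N. \<forall>t. (\<forall>M. (\<Sum>n<M. cmod (F (Complex 1 t) n)) \<le> real N)"
  proof (rule real_eventually_uniform)
    have "\<forall>\<^sub>F t in at_infinity. \<forall>M. (\<Sum>n<M. cmod (F (Complex 1 t) n)) \<le> 1"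
      using F by (simp add: Calderon_iff sum_null_def)
    then show "\<exists>N. \<forall>\<^sub>F t in at_infinity. \<forall>M. (\<Sum>n<M. cmod (F (Complex 1 t) n)) \<le> real N"
      by (intro exI[of _ 1]) simp
    fix s
    define C where "C = vnorm ell_1 (F (Complex 1 s))"
    have Fs: "F (Complex 1 s) \<in> vecs ell_1" using F by (simp add: Calderon_iff)
    have C: "(\<Sum>n<M. cmod (F (Complex 1 s) n)) \<le> C" for M
      unfolding C_def by (rule norm_ell_1_ge[OF Fs])
    have "\<forall>\<^sub>F t in at s. \<forall>M. (\<Sum>n<M. cmod ((F (Complex 1 t) - F (Complex 1 s)) n)) \<le> 1"
      using F by (simp only: Calderon_iff sum_null_def)
    then have "\<forall>\<^sub>F t in nhds s. \<forall>M. (\<Sum>n<M. cmod ((F (Complex 1 t) - F (Complex 1 s)) n)) \<le> 1"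
      by (simp add: eventually_nhds_conv_at)
    then have "\<forall>\<^sub>F t in nhds s. \<forall>M. (\<Sum>n<M. cmod (F (Complex 1 t) n)) \<le> C + 1"
    proof eventually_elim
      case (elim t)
      show ?case
      proof
        fix M
        have "(\<Sum>n<M. cmod (F (Complex 1 t) n)) \<le> (\<Sum>n<M. cmod (F (Complex 1 s) n) + cmod ((F (Complex 1 t) - F (Complex 1 s)) n))"
          by (intro sum_mono) (simp add: norm_triangle_sub)
        then show "(\<Sum>n<M. cmod (F (Complex 1 t) n)) \<le> C + 1"
          using C[of M] elim[rule_format, of M] by (simp add: sum.distrib)
      qed
    qed
    moreover obtain N where "C + 1 \<le> real N" using real_arch_simple by blast
    ultimately show "\<exists>N. \<forall>\<^sub>F t in nhds s. \<forall>M. (\<Sum>n<M. cmod (F (Complex 1 t) n)) \<le> real N"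
      by (intro exI[of _ N]) (auto elim!: eventually_mono intro: order_trans)
  qed (meson of_nat_mono order_trans)
  then show ?thesis by blast
qed

lemma Calderon_norm_le:
  assumes F: "F \<in> vecs Calderon" and "\<And>t n. cmod (F (Complex 0 t) n) \<le> A"
    and "\<And>t N. (\<Sum>n<N. cmod (F (Complex 1 t) n)) \<le> A"
  shows "vnorm Calderon F \<le> A"
proof -
  have "F (Complex 1 t) \<in> vecs ell_1" for t using F by (simp add: Calderon_iff)
  then have "(SUP t. vnorm ell_1 (F (Complex 1 t))) \<le> A"
    using assms(3) by (intro cSUP_least norm_ell_1_le) auto
  moreover have "(SUP t. vnorm ell_inf (F (Complex 0 t))) \<le> A"
    using assms(2) by (intro cSUP_least norm_ell_inf_le) auto
  ultimately show ?thesis by (simp add: Calderon_def calderon_def)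
qed

lemma Calderon_norm_ge_0:
  assumes F: "F \<in> vecs Calderon"
  shows "cmod (F (Complex 0 t) n) \<le> vnorm Calderon F"
proof -
  obtain B where B: "\<And>z n. cmod (F z n) \<le> B" using Calderon_bounded[OF F] by blast
  then have "F (Complex 0 t) \<in> vecs ell_inf" unfolding vecs_ell_inf by blast
  then have "cmod (F (Complex 0 t) n) \<le> vnorm ell_inf (F (Complex 0 t))" by (rule norm_ell_inf_ge)
  also have "\<dots> \<le> (SUP t. vnorm ell_inf (F (Complex 0 t)))"
    by (intro cSUP_upper bdd_aboveI2[where M = B] norm_ell_inf_le B) simp
  also have "\<dots> \<le> vnorm Calderon F" by (simp add: Calderon_def calderon_def)
  finally show ?thesis .
qed

lemma Calderon_norm_ge_1:
  assumes F: "F \<in> vecs Calderon"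
  shows "(\<Sum>n<N. cmod (F (Complex 1 t) n)) \<le> vnorm Calderon F"
proof -
  obtain C where C: "\<And>t N. (\<Sum>n<N. cmod (F (Complex 1 t) n)) \<le> C"
    using Calderon_bounded_sums[OF F] by blast
  have F1: "F (Complex 1 t) \<in> vecs ell_1" for t using F by (simp add: Calderon_iff)
  have "(\<Sum>n<N. cmod (F (Complex 1 t) n)) \<le> vnorm ell_1 (F (Complex 1 t))" by (rule norm_ell_1_ge[OF F1])
  also have "\<dots> \<le> (SUP t. vnorm ell_1 (F (Complex 1 t)))"
    by (intro cSUP_upper bdd_aboveI2[where M = C] norm_ell_1_le C F1) simp
  also have "\<dots> \<le> vnorm Calderon F" by (simp add: Calderon_def calderon_def)
  finally show ?thesis .
qed

lemma Calderon_norm_nonneg: "F \<in> vecs Calderon \<Longrightarrow> 0 \<le> vnorm Calderon F"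
  using Calderon_norm_ge_1[of F 0 0] by simp

lemma Calderon_norm_add:
  assumes F: "F \<in> vecs Calderon" and G: "G \<in> vecs Calderon"
  shows "vnorm Calderon (F + G) \<le> vnorm Calderon F + vnorm Calderon G"
proof (rule Calderon_norm_le[OF Calderon_add[OF F G]])
  show "cmod ((F + G) (Complex 0 t) n) \<le> vnorm Calderon F + vnorm Calderon G" for t n
    using norm_triangle_mono[OF Calderon_norm_ge_0[OF F] Calderon_norm_ge_0[OF G]] by simp
  fix t N
  have "(\<Sum>n<N. cmod ((F + G) (Complex 1 t) n)) \<le> (\<Sum>n<N. cmod (F (Complex 1 t) n)) + (\<Sum>n<N. cmod (G (Complex 1 t) n))"
    unfolding sum.distrib[symmetric] by (intro sum_mono) (simp add: norm_triangle_ineq)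
  then show "(\<Sum>n<N. cmod ((F + G) (Complex 1 t) n)) \<le> vnorm Calderon F + vnorm Calderon G"
    using Calderon_norm_ge_1[OF F, of t N] Calderon_norm_ge_1[OF G, of t N] by linarith
qed

lemma Calderon_norm_scale:
  assumes F: "F \<in> vecs Calderon"
  shows "vnorm Calderon (c *\<^sub>C F) \<le> cmod c * vnorm Calderon F"
proof (rule Calderon_norm_le[OF Calderon_scale[OF F]])
  show "cmod ((c *\<^sub>C F) (Complex 0 t) n) \<le> cmod c * vnorm Calderon F" for t n
    using Calderon_norm_ge_0[OF F] by (simp add: scaleC_coord norm_mult mult_left_mono)
  show "(\<Sum>n<N. cmod ((c *\<^sub>C F) (Complex 1 t) n)) \<le> cmod c * vnorm Calderon F" for t N
    using Calderon_norm_ge_1[OF F]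
    by (simp add: scaleC_coord norm_mult mult_left_mono sum_distrib_left[symmetric])
qed

section \<open>Taylor coefficients at the centre and the product estimate\<close>

lemma Delta_eq:
  assumes F: "F \<in> vecs Calderon"
  shows "Delta k F n = (deriv ^^ k) (\<lambda>z. F z n) (1/2) / fact k"
proof -
  obtain B where B: "\<And>z n. cmod (F z n) \<le> B" using Calderon_bounded[OF F] by blast
  have "(vderiv Sig ^^ k) F (1/2) = (\<lambda>n. (deriv ^^ k) (\<lambda>w. F w n) (1/2))"
    by (rule higher_vderiv_coordinatewise[OF open_open_strip Calderon_holomorphic[OF F] B half_in_open_strip])
  then show ?thesis
    by (simp add: Delta_def taylor_coeff_def scaleC_fun_def scaleC_complex_def field_simps)
qed

lemma Delta_add:
  assumes F: "F \<in> vecs Calderon" and G: "G \<in> vecs Calderon"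
  shows "Delta k (F + G) = Delta k F + Delta k G"
proof
  fix n
  show "Delta k (F + G) n = (Delta k F + Delta k G) n"
    using higher_deriv_add[OF Calderon_holomorphic[OF F] Calderon_holomorphic[OF G] open_open_strip half_in_open_strip, of k n n]
    by (simp add: Delta_eq F G Calderon_add add_divide_distrib)
qed

lemma Delta_diagonal:
  assumes F: "F \<in> vecs Calderon" and c: "\<And>n. cmod (c n) \<le> C"
  shows "Delta k (\<lambda>z n. c n * F z n) n = c n * Delta k F n"
  using higher_deriv_cmult[OF Calderon_holomorphic[OF F] half_in_open_strip open_open_strip, of k "c n" n]
  by (simp add: Delta_eq F Calderon_diagonal[OF F c])

lemma Delta_restr: "F \<in> vecs Calderon \<Longrightarrow> Delta k (\<lambda>z. restr A (F z)) = restr A (Delta k F)"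
  unfolding restr_eq_mult by (rule ext, rule Delta_diagonal[where C = 1]) auto

lemma Delta_scale:
  assumes "F \<in> vecs Calderon" shows "Delta k (c *\<^sub>C F) = c *\<^sub>C Delta k F"
proof
  show "Delta k (c *\<^sub>C F) n = (c *\<^sub>C Delta k F) n" for n
    using Delta_diagonal[of F "\<lambda>_. c" "cmod c" k n] assms by (simp add: scaleC_fun_def scaleC_complex_def)
qed

text \<open>The sum of the coordinates of \<open>F z * G (1 - z)\<close> is bounded on the strip by \<open>\<parallel>F\<parallel> \<parallel>G\<parallel>\<close>;
  rotating the coordinates by unimodular constants gives absolute convergence of its second
  Taylor coefficient.\<close>

lemma pairing_bound:
  assumes F: "F \<in> vecs Calderon" and G: "G \<in> vecs Calderon"
  shows "(\<Sum>n<N. cmod (Delta 2 F n * Delta 0 G n - Delta 1 F n * Delta 1 G n + Delta 0 F n * Delta 2 G n))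
    \<le> 4 * vnorm Calderon F * vnorm Calderon G"
proof -
  define p where "p n = Delta 2 F n * Delta 0 G n - Delta 1 F n * Delta 1 G n + Delta 0 F n * Delta 2 G n" for n
  define c where "c n = cnj (sgn (p n))" for n
  have cp: "c n * p n = of_real (cmod (p n))" for n
  proof -
    have "c n * p n = p n * cnj (p n) / of_real (cmod (p n))"
      by (simp add: c_def sgn_eq)
    also have "\<dots> = of_real ((cmod (p n))\<^sup>2) / of_real (cmod (p n))"
      by (simp only: complex_norm_square)
    also have "\<dots> = of_real (cmod (p n))"
      by (simp add: power2_eq_square)
    finally show ?thesis .
  qed
  have c1: "cmod (c n) \<le> 1" for n by (simp add: c_def norm_sgn)
  have refl: "1 - z \<in> strip \<longleftrightarrow> z \<in> strip" "1 - z \<in> open_strip \<longleftrightarrow> z \<in> open_strip" for z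
    by (auto simp: strip_def open_strip_def)
  define q where "q n z = F z n * G (1 - z) n" for n z
  have holF: "(\<lambda>z. F z n) holomorphic_on open_strip" for n by (rule Calderon_holomorphic[OF F])
  have holG: "(\<lambda>z. G (1 - z) n) holomorphic_on open_strip" for n
    by (rule holomorphic_on_compose_gen[OF _ Calderon_holomorphic[OF G], unfolded o_def])
      (auto intro!: holomorphic_intros simp: refl)
  have holq: "q n holomorphic_on open_strip" for n
    unfolding q_def by (intro holomorphic_intros holF holG)
  have contq: "continuous_on strip (q n)" for n
    unfolding q_def
    by (intro continuous_intros Calderon_continuous F
        continuous_on_compose2[OF Calderon_continuous[OF G]]) (auto simp: refl)
  \<comment> \<open>The reflection fixes 1/2, so the k-th derivative only picks up the sign (-1)^k;
    this produces the minus sign before the product of the first coefficients.\<close>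
  have Gref: "(deriv ^^ k) (\<lambda>z. G (1 - z) n) (1/2) = (-1)^k * (deriv ^^ k) (\<lambda>z. G z n) (1/2)" for k n
    using higher_deriv_compose_linear'[OF Calderon_holomorphic[OF G] open_open_strip open_open_strip
        half_in_open_strip, of "-1" 1 k n]
    by (simp add: refl)
  have d2q: "(deriv ^^ 2) (q n) (1/2) = 2 * p n" for n
  proof -
    have sum3: "(\<Sum>i=0..2. f i) = f 0 + f 1 + f 2" for f :: "nat \<Rightarrow> complex"
      by (simp add: numeral_2_eq_2)
    show ?thesis
      unfolding q_def higher_deriv_mult[OF holF holG open_open_strip half_in_open_strip] sum3
      using Gref[of 1 n] Gref[of 2 n]
      by (simp add: p_def Delta_eq[OF F] Delta_eq[OF G] fact_numeral algebra_simps)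
  qed
  define h where "h N z = (\<Sum>n<N. c n * q n z)" for N z
  have holh: "h N holomorphic_on open_strip" for N
    unfolding h_def by (intro holomorphic_intros holq)
  have "(deriv ^^ 2) (h N) (1/2) = 2 * of_real (\<Sum>n<N. cmod (p n))" for N
  proof (induction N)
    case 0
    have "h 0 = (\<lambda>z. 0)" by (simp add: h_def fun_eq_iff)
    then show ?case by (simp add: numeral_2_eq_2)
  next
    case (Suc N)
    have "h (Suc N) = (\<lambda>z. h N z + c N * q N z)" by (simp add: h_def fun_eq_iff)
    moreover have "(\<lambda>z. c N * q N z) holomorphic_on open_strip"
      by (intro holomorphic_intros holq)
    ultimately have "(deriv ^^ 2) (h (Suc N)) (1/2) = (deriv ^^ 2) (h N) (1/2) + (deriv ^^ 2) (\<lambda>z. c N * q N z) (1/2)"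
      using higher_deriv_add[OF holh _ open_open_strip half_in_open_strip] by simp
    also have "(deriv ^^ 2) (\<lambda>z. c N * q N z) (1/2) = c N * (2 * p N)"
      using higher_deriv_cmult[OF holq half_in_open_strip open_open_strip] d2q by simp
    also have "\<dots> = 2 * of_real (cmod (p N))" using cp[of N] by simp
    finally show ?case using Suc by simp
  qed
  then have "2 * (\<Sum>n<N. cmod (p n)) = cmod ((deriv ^^ 2) (h N) (1/2))"
    by (simp add: norm_mult sum_nonneg del: of_real_sum)
  also have "\<dots> \<le> 8 * (vnorm Calderon F * vnorm Calderon G)"
  proof -
    obtain A where A: "\<And>z n. cmod (F z n) \<le> A" using Calderon_bounded[OF F] by blast
    obtain B where B: "\<And>z n. cmod (G z n) \<le> B" using Calderon_bounded[OF G] by blast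
    have A0: "A \<ge> 0" using A norm_ge_zero order_trans by blast
    have le: "cmod (h N z) \<le> (\<Sum>n<N. cmod (F z n) * cmod (G (1 - z) n))" for z
      unfolding h_def q_def using c1
      by (intro sum_norm_le) (simp add: norm_mult mult_left_le_one_le)
    note Fn = Calderon_norm_nonneg[OF F] and Gn = Calderon_norm_nonneg[OF G]
    show ?thesis
    proof (rule strip_second_deriv_bound)
      show "continuous_on strip (h N)" unfolding h_def by (intro continuous_intros contq)
      show "h N holomorphic_on open_strip" by (rule holh)
      \<comment> \<open>A crude bound depending on \<open>N\<close>: the maximum principle only asks
        that some bound exist, and its size does not enter the result.\<close>
      show "cmod (h N z) \<le> (\<Sum>n<N. A * B)" if "z \<in> strip" for z
        using le[of z] sum_mono[of "{..<N}" "\<lambda>n. cmod (F z n) * cmod (G (1 - z) n)" "\<lambda>n. A * B"]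
          mult_mono[OF A B A0] by (meson norm_ge_zero order_trans)
      fix z assume "z \<in> strip" and z: "Re z = 0 \<or> Re z = 1"
      then consider t where "z = Complex 0 t" | t where "z = Complex 1 t"
        by (metis complex.collapse)
      then show "cmod (h N z) \<le> vnorm Calderon F * vnorm Calderon G"
      proof cases
        case 1
        have 11: "1 - z = Complex 1 (-t)" by (simp add: 1 complex_eq_iff)
        have "(\<Sum>n<N. cmod (F z n) * cmod (G (1 - z) n)) \<le> (\<Sum>n<N. vnorm Calderon F * cmod (G (1 - z) n))"
          by (intro sum_mono mult_right_mono) (simp_all add: 1 Calderon_norm_ge_0[OF F])
        also have "\<dots> \<le> vnorm Calderon F * vnorm Calderon G"
          unfolding sum_distrib_left[symmetric] 11
          by (intro mult_left_mono Calderon_norm_ge_1 G Fn)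
        finally show ?thesis using le[of z] by linarith
      next
        case 2
        have 21: "1 - z = Complex 0 (-t)" by (simp add: 2 complex_eq_iff)
        have "(\<Sum>n<N. cmod (F z n) * cmod (G (1 - z) n)) \<le> (\<Sum>n<N. cmod (F z n) * vnorm Calderon G)"
          unfolding 21 by (intro sum_mono mult_left_mono) (simp_all add: Calderon_norm_ge_0[OF G])
        also have "\<dots> \<le> vnorm Calderon F * vnorm Calderon G"
          unfolding sum_distrib_right[symmetric] 2
          by (intro mult_right_mono Calderon_norm_ge_1 F Gn)
        finally show ?thesis using le[of z] by linarith
      qed
    qed
  qed
  finally show ?thesis by (simp add: p_def)
qed

text \<open>Elements of the Calderon space take values in \<open>c\<^sub>0\<close>: on the right boundary line the
  coordinates tend to zero uniformly, and the three lines theorem carries this to the interior.\<close>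

lemma Calderon_tail_1:
  assumes F: "F \<in> vecs Calderon" and e: "e > 0"
  shows "\<exists>N. \<forall>t M. (\<Sum>n\<in>{N..<M}. cmod (F (Complex 1 t) n)) \<le> e"
proof (rule real_eventually_uniform[where P = "\<lambda>N t. \<forall>M. (\<Sum>n\<in>{N..<M}. cmod (F (Complex 1 t) n)) \<le> e"])
  have sub: "(\<Sum>n\<in>{N..<M}. cmod (x n)) \<le> (\<Sum>n<M. cmod (x n))" for N M and x :: "nat \<Rightarrow> complex"
    by (intro sum_mono2) auto
  have "\<forall>\<^sub>F t in at_infinity. \<forall>M. (\<Sum>n<M. cmod (F (Complex 1 t) n)) \<le> e"
    using F e by (simp add: Calderon_iff sum_null_def)
  then have "\<forall>\<^sub>F t in at_infinity. \<forall>M. (\<Sum>n\<in>{0..<M}. cmod (F (Complex 1 t) n)) \<le> e"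
    by (simp add: atLeast0LessThan)
  then show "\<exists>N. \<forall>\<^sub>F t in at_infinity. \<forall>M. (\<Sum>n\<in>{N..<M}. cmod (F (Complex 1 t) n)) \<le> e" by blast
  fix s
  have "summable (\<lambda>n. cmod (F (Complex 1 s) n))" using F by (simp add: Calderon_iff vecs_ell_1)
  then obtain N where N: "\<And>m M. m \<ge> N \<Longrightarrow> norm (\<Sum>n\<in>{m..<M}. cmod (F (Complex 1 s) n)) < e/2"
    using e unfolding summable_Cauchy by (meson half_gt_zero)
  have "\<forall>\<^sub>F t in at s. \<forall>M. (\<Sum>n<M. cmod ((F (Complex 1 t) - F (Complex 1 s)) n)) \<le> e/2"
    using F half_gt_zero[OF e] by (simp only: Calderon_iff sum_null_def)
  then have "\<forall>\<^sub>F t in nhds s. \<forall>M. (\<Sum>n<M. cmod ((F (Complex 1 t) - F (Complex 1 s)) n)) \<le> e/2"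
    using e by (simp add: eventually_nhds_conv_at)
  then have "\<forall>\<^sub>F t in nhds s. \<forall>M. (\<Sum>n\<in>{N..<M}. cmod (F (Complex 1 t) n)) \<le> e"
  proof eventually_elim
    case (elim t)
    show ?case
    proof
      fix M
      have "(\<Sum>n\<in>{N..<M}. cmod (F (Complex 1 t) n)) \<le> (\<Sum>n\<in>{N..<M}. cmod (F (Complex 1 s) n) + cmod ((F (Complex 1 t) - F (Complex 1 s)) n))"
        by (intro sum_mono) (simp add: norm_triangle_sub)
      also have "\<dots> = (\<Sum>n\<in>{N..<M}. cmod (F (Complex 1 s) n)) + (\<Sum>n\<in>{N..<M}. cmod ((F (Complex 1 t) - F (Complex 1 s)) n))"
        by (rule sum.distrib)
      also have "(\<Sum>n\<in>{N..<M}. cmod (F (Complex 1 s) n)) \<le> norm (\<Sum>n\<in>{N..<M}. cmod (F (Complex 1 s) n))"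
        by simp
      finally show "(\<Sum>n\<in>{N..<M}. cmod (F (Complex 1 t) n)) \<le> e"
        using N[OF order_refl, of M] elim[rule_format, of M] sub[where N=N and M=M and x="F (Complex 1 t) - F (Complex 1 s)"]
        by linarith
    qed
  qed
  then show "\<exists>N. \<forall>\<^sub>F t in nhds s. \<forall>M. (\<Sum>n\<in>{N..<M}. cmod (F (Complex 1 t) n)) \<le> e" by blast
next
  fix N M t assume *: "\<forall>K. (\<Sum>n\<in>{N..<K}. cmod (F (Complex 1 t) n)) \<le> e" and "N \<le> M"
  show "\<forall>K. (\<Sum>n\<in>{M..<K}. cmod (F (Complex 1 t) n)) \<le> e"
  proof
    fix K
    have "(\<Sum>n\<in>{M..<K}. cmod (F (Complex 1 t) n)) \<le> (\<Sum>n\<in>{N..<K}. cmod (F (Complex 1 t) n))"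
      using \<open>N \<le> M\<close> by (intro sum_mono2) auto
    then show "(\<Sum>n\<in>{M..<K}. cmod (F (Complex 1 t) n)) \<le> e" using * order_trans by blast
  qed
qed

text \<open>The three lines bound degenerates at \<open>Re z = 0\<close>. Norm continuity allows a
  step of length \<open>\<theta>\<close> into the strip, where the smallness on the right line is
  felt. The three thirds of \<open>e\<close> pay for the value at \<open>w\<close>, the step back to
  the boundary point over \<open>s\<close>, and the passage to nearby \<open>t\<close>.\<close>

lemma Calderon_tail_0:
  assumes F: "F \<in> vecs Calderon" and e: "e > 0"
  shows "\<exists>N. \<forall>t. \<forall>n\<ge>N. cmod (F (Complex 0 t) n) \<le> e"
proof (rule real_eventually_uniform[where P = "\<lambda>N t. \<forall>n\<ge>N. cmod (F (Complex 0 t) n) \<le> e"])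
  have "\<forall>\<^sub>F t in at_infinity. \<forall>n. cmod (F (Complex 0 t) n) \<le> e"
    using F e by (simp add: Calderon_iff unif_null_def)
  then show "\<exists>N. \<forall>\<^sub>F t in at_infinity. \<forall>n\<ge>N. cmod (F (Complex 0 t) n) \<le> e"
    by (intro exI[of _ 0]) simp
  fix s
  have "unif_null (\<lambda>z. F z - F (Complex 0 s)) (at (Complex 0 s) within strip)"
    using F by (simp add: Calderon_iff strip_def)
  moreover have e3: "e/3 > 0" using e by simp
  ultimately have "\<forall>\<^sub>F z in at (Complex 0 s) within strip. \<forall>n. cmod ((F z - F (Complex 0 s)) n) \<le> e/3"
    unfolding unif_null_def by blast
  then obtain d where d: "d > 0"
    "\<And>z n. z \<in> strip \<Longrightarrow> dist z (Complex 0 s) < d \<Longrightarrow> cmod (F z n - F (Complex 0 s) n) \<le> e/3"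
    using e3 unfolding eventually_at
    by (metis diff_self less_imp_le minus_apply norm_zero)
  define \<theta> where "\<theta> = min (d/2) 1"
  have th: "\<theta> > 0" "\<theta> \<le> 1" "\<theta> < d" using d by (auto simp: \<theta>_def)
  define w where "w = Complex \<theta> s"
  have w: "w \<in> strip" "Re w = \<theta>" "dist w (Complex 0 s) < d"
    using th by (auto simp: w_def strip_def dist_norm complex_diff complex_norm)
  obtain B' where B': "\<And>z n. cmod (F z n) \<le> B'" using Calderon_bounded[OF F] by blast
  define B where "B = max B' 1"
  have B: "\<And>z n. cmod (F z n) \<le> B" "B > 0" using B' by (auto simp: B_def le_max_iff_disj)
  \<comment> \<open>\<open>\<theta>\<close> is fixed before \<open>x\<close>: as the exponent is
    positive, the bound tends to 0 with \<open>x\<close>, however small \<open>\<theta>\<close>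
    is.\<close>
  have "((\<lambda>x. B * (x / B) powr \<theta>) \<longlongrightarrow> B * (0 / B) powr \<theta>) (at_right 0)"
    using th B by (intro tendsto_intros tendsto_powr') (auto intro!: tendsto_eq_intros eventually_at_right_less simp: eventually_at_filter)
  then have "\<forall>\<^sub>F x in at_right 0. B * (x / B) powr \<theta> < e/3"
    using e by (intro order_tendstoD(2)) auto
  moreover have "\<forall>\<^sub>F x in at_right 0. 0 < x \<and> x < B"
    using B(2) by (rule eventually_at_right_real[of 0 B, simplified])
  ultimately obtain x where x: "0 < x" "x < B" "B * (x / B) powr \<theta> < e/3"
    by (metis (mono_tags, lifting) eventually_conj eventually_happens' trivial_limit_at_right_real)
  obtain N where N: "\<And>t M. (\<Sum>n\<in>{N..<M}. cmod (F (Complex 1 t) n)) \<le> x"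
    using Calderon_tail_1[OF F x(1)] by blast
  have small: "cmod (F (Complex 0 s) n) \<le> 2 * e / 3" if n: "n \<ge> N" for n
  proof -
    have "cmod (F w n) \<le> B * (x / B) powr Re w"
    proof (rule strip_three_lines[where f = "\<lambda>z. F z n" and z = w and B = B and d = x])
      fix z assume "Re z = 1"
      then obtain t where z: "z = Complex 1 t" by (metis complex.collapse)
      have "cmod (F z n) \<le> (\<Sum>k\<in>{N..<Suc n}. cmod (F z k))"
        by (rule member_le_sum) (use n in auto)
      then show "cmod (F z n) \<le> x" using N[where t=t and M="Suc n"] z by simp
    qed (use B x w Calderon_continuous[OF F] Calderon_holomorphic[OF F] in auto)
    then have "cmod (F w n) \<le> e/3" using x(3) w(2) by simp
    moreover have "cmod (F w n - F (Complex 0 s) n) \<le> e/3" by (rule d(2)[OF w(1,3)])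
    ultimately show ?thesis
      using norm_triangle_sub[of "F (Complex 0 s) n" "F w n"] by (simp add: norm_minus_commute)
  qed
  have "((\<lambda>t. Complex 0 t) \<longlongrightarrow> Complex 0 s) (nhds s)"
    by (intro tendsto_intros) (simp add: filterlim_ident)
  then have "\<forall>\<^sub>F t in nhds s. dist (Complex 0 t) (Complex 0 s) < d"
    using d(1) by (rule tendstoD)
  then have "\<forall>\<^sub>F t in nhds s. \<forall>n\<ge>N. cmod (F (Complex 0 t) n) \<le> e"
  proof eventually_elim
    case (elim t)
    have t: "Complex 0 t \<in> strip" by (simp add: strip_def)
    show ?case
    proof (intro allI impI)
      fix n assume "n \<ge> N"
      then show "cmod (F (Complex 0 t) n) \<le> e"
        using d(2)[OF t elim, of n] small[of n] norm_triangle_sub[of "F (Complex 0 t) n" "F (Complex 0 s) n"]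
        by linarith
    qed
  qed
  then show "\<exists>N. \<forall>\<^sub>F t in nhds s. \<forall>n\<ge>N. cmod (F (Complex 0 t) n) \<le> e" by blast
qed auto

text \<open>This approximation by truncated functions is what reduces the vanishing of a functional
  to its values on unit vectors.\<close>

lemma Calderon_tail:
  assumes F: "F \<in> vecs Calderon" and e: "e > 0"
  shows "\<exists>N. vnorm Calderon (\<lambda>z. restr {N..} (F z)) \<le> e"
proof -
  obtain N0 where N0: "\<And>t n. n \<ge> N0 \<Longrightarrow> cmod (F (Complex 0 t) n) \<le> e"
    using Calderon_tail_0[OF F e] by blast
  obtain N1 where N1: "\<And>t M. (\<Sum>n\<in>{N1..<M}. cmod (F (Complex 1 t) n)) \<le> e"
    using Calderon_tail_1[OF F e] by blast
  let ?N = "max N0 N1"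
  have "vnorm Calderon (\<lambda>z. restr {?N..} (F z)) \<le> e"
  proof (rule Calderon_norm_le[OF Calderon_restr[OF F]])
    show "cmod (restr {?N..} (F (Complex 0 t)) n) \<le> e" for t n
      using N0 e by (simp add: restr_def)
    fix t M
    have "(\<Sum>n<M. cmod (restr {?N..} (F (Complex 1 t)) n)) = (\<Sum>n\<in>{?N..<M}. cmod (F (Complex 1 t) n))"
      by (rule sum.mono_neutral_cong_right) (auto simp: restr_def)
    also have "\<dots> \<le> (\<Sum>n\<in>{N1..<M}. cmod (F (Complex 1 t) n))"
      by (rule sum_mono2) auto
    finally show "(\<Sum>n<M. cmod (restr {?N..} (F (Complex 1 t)) n)) \<le> e" using N1[of t M] by linarith
  qed
  then show ?thesis by blast
qed

subsection \<open>Explicit elements of the Calderon space\<close>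

text \<open>A null majorant turns coordinatewise continuity into sup-norm continuity: finitely many
  coordinates are handled one by one and the rest are uniformly small. A summable majorant does the
  same for the norm of \<open>ell_1\<close> on the right line.\<close>

lemma Calderon_memI:
  assumes off: "\<And>z. z \<notin> strip \<Longrightarrow> f z = 0"
    and cont: "\<And>n. continuous_on strip (\<lambda>z. f z n)"
    and hol: "\<And>n. (\<lambda>z. f z n) holomorphic_on open_strip"
    and M: "\<And>z n. z \<in> strip \<Longrightarrow> cmod (f z n) \<le> M n" and M0: "M \<longlonglongrightarrow> 0"
    and b0: "unif_null (\<lambda>t. f (Complex 0 t)) at_infinity"
    and K: "\<And>t n. cmod (f (Complex 1 t) n) \<le> K n" and sK: "summable K"
    and b1: "sum_null (\<lambda>t. f (Complex 1 t)) at_infinity"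
  shows "f \<in> vecs Calderon"
proof -
  have "Bseq M" using M0 convergentI convergent_imp_Bseq by blast
  then obtain B where B: "B > 0" "\<And>n. norm (M n) \<le> B" unfolding Bseq_def by blast
  have "cmod (f z n) \<le> B" for z n
  proof (cases "z \<in> strip")
    case True
    then show ?thesis using M[OF True, of n] B(2)[of n] by simp
  next
    case False then show ?thesis using off B by simp
  qed
  moreover have "unif_null (\<lambda>z. f z - f s) (at s within strip)" if s: "s \<in> strip" for s
    unfolding unif_null_def
  proof (intro allI impI)
    fix e :: real assume e: "e > 0"
    then have "\<forall>\<^sub>F n in sequentially. M n < e/2" using M0 by (intro order_tendstoD(2)) auto
    then obtain N where N: "\<And>n. n \<ge> N \<Longrightarrow> M n < e/2" by (auto simp: eventually_sequentially)
    have "\<forall>\<^sub>F z in at s within strip. cmod (f z n - f s n) < e" for n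
    proof -
      have "((\<lambda>z. f z n) \<longlongrightarrow> f s n) (at s within strip)"
        using cont s by (auto simp: continuous_on_def)
      from tendstoD[OF this e] show ?thesis by (simp add: dist_norm)
    qed
    then have "\<forall>\<^sub>F z in at s within strip. \<forall>n\<in>{..<N}. cmod (f z n - f s n) < e"
      by (intro eventually_ball_finite) auto
    moreover have "\<forall>\<^sub>F z in at s within strip. z \<in> strip" by (simp add: eventually_at_filter)
    ultimately show "\<forall>\<^sub>F z in at s within strip. \<forall>n. cmod ((f z - f s) n) \<le> e"
    proof eventually_elim
      case (elim z)
      show ?case
      proof
        fix n
        show "cmod ((f z - f s) n) \<le> e"
        proof (cases "n < N")
          case True then show ?thesis using elim by (simp add: less_imp_le)
        next
          case False
          then show ?thesis
            using N[of n] M[OF elim(2), of n] M[OF s, of n] norm_triangle_ineq4[of "f z n" "f s n"] by simp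
        qed
      qed
    qed
  qed
  moreover have "f (Complex 1 t) \<in> vecs ell_1" for t
    unfolding vecs_ell_1 by (rule summable_comparison_test'[OF sK, of 0]) (simp add: K)
  moreover have "sum_null (\<lambda>t. f (Complex 1 t) - f (Complex 1 s)) (at s)" for s
    unfolding sum_null_def
  proof (intro allI impI)
    fix e :: real assume e: "e > 0"
    obtain N where N: "\<And>m M. m \<ge> N \<Longrightarrow> norm (\<Sum>n\<in>{m..<M}. K n) < e/4"
      using sK e unfolding summable_Cauchy by (meson zero_less_divide_iff zero_less_numeral)
    have lim: "((\<lambda>t. \<Sum>n<N. cmod (f (Complex 1 t) n - f (Complex 1 s) n)) \<longlongrightarrow>
        (\<Sum>n<N. cmod (f (Complex 1 s) n - f (Complex 1 s) n))) (at s)"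
    proof (intro tendsto_intros)
      fix n
      have "continuous_on UNIV (\<lambda>t. f (Complex 1 t) n)"
        by (rule continuous_on_compose2[OF cont, where f = "Complex 1"])
          (auto simp: strip_def intro!: continuous_intros)
      then show "((\<lambda>t. f (Complex 1 t) n) \<longlongrightarrow> f (Complex 1 s) n) (at s)"
        by (auto simp: continuous_on_def)
    qed
    have "\<forall>\<^sub>F t in at s. (\<Sum>n<N. cmod (f (Complex 1 t) n - f (Complex 1 s) n)) < e/2"
      using order_tendstoD(2)[OF lim, of "e/2"] e by simp
    then show "\<forall>\<^sub>F t in at s. \<forall>M. (\<Sum>n<M. cmod ((f (Complex 1 t) - f (Complex 1 s)) n)) \<le> e"
    proof eventually_elim
      case (elim t)
      let ?g = "\<lambda>n. cmod (f (Complex 1 t) n - f (Complex 1 s) n)"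
      show ?case
      proof
        fix M
        have "(\<Sum>n<M. ?g n) \<le> (\<Sum>n\<in>{..<N} \<union> {N..<M}. ?g n)"
          by (rule sum_mono2) auto
        also have "\<dots> = (\<Sum>n<N. ?g n) + (\<Sum>n\<in>{N..<M}. ?g n)"
          by (rule sum.union_disjoint) auto
        also have "(\<Sum>n\<in>{N..<M}. ?g n) \<le> (\<Sum>n\<in>{N..<M}. 2 * K n)"
        proof (rule sum_mono)
          fix n show "?g n \<le> 2 * K n"
            using K[of t n] K[of s n] norm_triangle_ineq4[of "f (Complex 1 t) n" "f (Complex 1 s) n"] by simp
        qed
        also have "\<dots> = 2 * (\<Sum>n\<in>{N..<M}. K n)" by (simp add: sum_distrib_left)
        also have "(\<Sum>n\<in>{N..<M}. K n) \<le> norm (\<Sum>n\<in>{N..<M}. K n)" by simp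
        finally show "(\<Sum>n<M. cmod ((f (Complex 1 t) - f (Complex 1 s)) n)) \<le> e"
          using elim N[OF order_refl, of M] by simp
      qed
    qed
  qed
  ultimately show ?thesis using off hol b0 b1 unfolding Calderon_iff by blast
qed

text \<open>With \<open>u = z - 1/2\<close>, these are perturbations of the extremal functions
  \<open>z \<mapsto> x \<bar>x\<bar> powr (2 * z - 1)\<close>, with the exponents \<open>r n\<close> in place of \<open>ln \<bar>x n\<bar>\<close>;
  the Gaussian factor provides the decay at infinity.\<close>

definition gaussian_exp ::
  "(nat \<Rightarrow> complex) \<Rightarrow> (nat \<Rightarrow> complex) \<Rightarrow> (nat \<Rightarrow> complex) \<Rightarrow> (nat \<Rightarrow> real) \<Rightarrow> complex \<Rightarrow> nat \<Rightarrow> complex"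
  where "gaussian_exp a b c r z n = (if z \<in> strip then
     exp ((z - 1/2)\<^sup>2) * (a n + b n * (z - 1/2) + c n * (z - 1/2)\<^sup>2) * exp (2 * (z - 1/2) * of_real (r n))
     else 0)"

text \<open>The quadratic factor costs half of the Gaussian decay: \<open>exp (u\<^sup>2)\<close>
  has modulus at most \<open>3 * exp (- t\<^sup>2)\<close> and the polynomial at most
  \<open>4 * q * exp (t\<^sup>2 / 2)\<close>. Their product is the origin of the 12 in all later
  norms.\<close>

lemma gaussian_exp_bound:
  assumes z: "z \<in> strip" and q: "cmod (a n) \<le> q" "cmod (b n) \<le> q" "cmod (c n) \<le> q"
  shows "cmod (gaussian_exp a b c r z n) \<le> 12 * exp (- (Im z)\<^sup>2 / 2) * (q * exp ((2 * Re z - 1) * r n))"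
proof -
  define u where "u = z - 1/2"
  define t where "t = Im z"
  have Reu: "Re u = Re z - 1/2" "Im u = t" by (simp_all add: u_def t_def)
  have Reu2: "(Re u)\<^sup>2 \<le> 1/4"
  proof -
    have "\<bar>Re u\<bar> \<le> 1/2" using z unfolding Reu strip_def abs_le_iff by auto
    then have "\<bar>Re u\<bar>\<^sup>2 \<le> (1/2)\<^sup>2" by (intro power_mono) auto
    then show ?thesis by (simp add: power2_eq_square)
  qed
  have cu2: "(cmod u)\<^sup>2 \<le> 1/4 + t\<^sup>2" using Reu2 by (simp add: cmod_power2 Reu(2))
  have q0: "q \<ge> 0" using q(1) norm_ge_zero order_trans by blast
  have "2 * cmod u \<le> 1 + (cmod u)\<^sup>2"
    using sum_squares_bound[of "cmod u" 1] by simp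
  then have poly: "1 + cmod u + (cmod u)\<^sup>2 \<le> 4 * (1 + t\<^sup>2 / 2)"
    using cu2 zero_le_power2[of t] by argo
  have e1: "1 + t\<^sup>2/2 \<le> exp (t\<^sup>2/2)" using exp_ge_add_one_self[of "t\<^sup>2/2"] by simp
  have "cmod (a n + b n * u + c n * u\<^sup>2) \<le> q + q * cmod u + q * (cmod u)\<^sup>2"
    using q by (intro order_trans[OF norm_triangle_ineq] add_mono)
      (auto simp: norm_mult norm_power mult_right_mono)
  also have "\<dots> = q * (1 + cmod u + (cmod u)\<^sup>2)" by (simp add: algebra_simps)
  also have "\<dots> \<le> q * (4 * exp (t\<^sup>2/2))"
    using order_trans[OF poly mult_left_mono[OF e1, of 4]] q0 by (intro mult_left_mono) auto
  finally have p: "cmod (a n + b n * u + c n * u\<^sup>2) \<le> q * (4 * exp (t\<^sup>2/2))" .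
  have Re_u2: "Re (u\<^sup>2) = (Re u)\<^sup>2 - t\<^sup>2" by (simp add: power2_eq_square Reu(2))
  have "exp (1/4::real) \<le> 3" using exp_le exp_le_cancel_iff[of "1/4" "1::real"] by (smt (verit) divide_less_eq_1)
  have "cmod (exp (u\<^sup>2)) = exp (Re (u\<^sup>2))" by simp
  also have "\<dots> \<le> exp (1/4 + (- t\<^sup>2))" using Reu2 by (simp add: Re_u2)
  also have "\<dots> \<le> 3 * exp (- t\<^sup>2)" unfolding exp_add
    using \<open>exp (1/4::real) \<le> 3\<close> by (intro mult_right_mono) auto
  finally have g: "cmod (exp (u\<^sup>2)) \<le> 3 * exp (- t\<^sup>2)" .
  have x: "cmod (exp (2 * u * of_real (r n))) = exp ((2 * Re z - 1) * r n)"
    by (simp add: Reu algebra_simps)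
  have "cmod (gaussian_exp a b c r z n) =
      cmod (exp (u\<^sup>2)) * cmod (a n + b n * u + c n * u\<^sup>2) * cmod (exp (2 * u * of_real (r n)))"
    using z unfolding gaussian_exp_def u_def by (simp add: norm_mult)
  also have "\<dots> \<le> (3 * exp (- t\<^sup>2)) * (q * (4 * exp (t\<^sup>2/2))) * exp ((2 * Re z - 1) * r n)"
    unfolding x by (intro mult_right_mono mult_mono g p) auto
  also have "\<dots> = 12 * (exp (- t\<^sup>2) * exp (t\<^sup>2/2)) * (q * exp ((2 * Re z - 1) * r n))" by simp
  also have "exp (- t\<^sup>2) * exp (t\<^sup>2/2) = exp (- t\<^sup>2/2)"
    unfolding exp_add[symmetric] by simp
  finally show ?thesis by (simp add: t_def)
qed

lemma tendsto_gaussian: "((\<lambda>t::real. C * exp (- t\<^sup>2 / 2)) \<longlongrightarrow> 0) at_infinity"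
proof -
  have "((\<lambda>t::real. C * exp (- t\<^sup>2 / 2)) \<longlongrightarrow> 0) at_top" by real_asymp
  moreover have "((\<lambda>t::real. C * exp (- t\<^sup>2 / 2)) \<longlongrightarrow> 0) at_bot" by real_asymp
  ultimately show ?thesis unfolding at_infinity_eq_at_top_bot by (rule filterlim_sup)
qed

text \<open>On the two lines the exponential factor has modulus \<open>exp (- r n)\<close> and
  \<open>exp (r n)\<close>, so \<open>A0\<close> controls the sup norm on the left and
  \<open>A1\<close> the sums on the right. As \<open>2 * Re z - 1\<close> lies in [-1, 1], the sum
  of both weights majorises the coordinates in between up to the factor 12; it is null by
  \<open>lim\<close> and by summability.\<close>

lemma
  assumes q: "\<And>n. cmod (a n) \<le> q n" "\<And>n. cmod (b n) \<le> q n" "\<And>n. cmod (c n) \<le> q n"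
    and lim: "(\<lambda>n. q n * exp (- r n)) \<longlonglongrightarrow> 0" and A0: "\<And>n. q n * exp (- r n) \<le> A"
    and A1: "\<And>N. (\<Sum>n<N. q n * exp (r n)) \<le> A"
  shows Calderon_gaussian_exp: "gaussian_exp a b c r \<in> vecs Calderon"
    and norm_gaussian_exp: "vnorm Calderon (gaussian_exp a b c r) \<le> 12 * A"
proof -
  let ?f = "gaussian_exp a b c r"
  have q0: "q n \<ge> 0" for n using q(1) norm_ge_zero order_trans by blast
  have A: "A \<ge> 0" using A1[of 0] by simp
  have sum: "summable (\<lambda>n. q n * exp (r n))"
    by (rule bounded_imp_summable[where B = A])
      (use q0 A1 in \<open>auto simp: lessThan_Suc_atMost[symmetric] simp del: sum.lessThan_Suc\<close>)
  have gauss_le: "exp (- t\<^sup>2 / 2) \<le> 1" for t :: real by simp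
  have f0: "cmod (?f (Complex 0 t) n) \<le> exp (- t\<^sup>2 / 2) * (12 * A)" for t n
  proof -
    have "cmod (?f (Complex 0 t) n) \<le> 12 * exp (- t\<^sup>2 / 2) * (q n * exp (- r n))"
      using gaussian_exp_bound[of "Complex 0 t" a n "q n" b c r] q by (simp add: strip_def)
    also have "\<dots> \<le> 12 * exp (- t\<^sup>2 / 2) * A" by (intro mult_left_mono A0) auto
    finally show ?thesis by (simp add: mult_ac)
  qed
  have f1n: "cmod (?f (Complex 1 t) n) \<le> 12 * exp (- t\<^sup>2 / 2) * (q n * exp (r n))" for t n
    using gaussian_exp_bound[of "Complex 1 t" a n "q n" b c r] q by (simp add: strip_def)
  have f1: "(\<Sum>n<N. cmod (?f (Complex 1 t) n)) \<le> exp (- t\<^sup>2 / 2) * (12 * A)" for t N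
  proof -
    have "(\<Sum>n<N. cmod (?f (Complex 1 t) n)) \<le> (\<Sum>n<N. 12 * exp (- t\<^sup>2 / 2) * (q n * exp (r n)))"
      by (intro sum_mono f1n)
    also have "\<dots> = 12 * exp (- t\<^sup>2 / 2) * (\<Sum>n<N. q n * exp (r n))" by (simp add: sum_distrib_left)
    also have "\<dots> \<le> 12 * exp (- t\<^sup>2 / 2) * A" by (intro mult_left_mono A1) auto
    finally show ?thesis by (simp add: mult_ac)
  qed
  show mem: "?f \<in> vecs Calderon"
  proof (rule Calderon_memI)
    show "?f z = 0" if "z \<notin> strip" for z using that by (simp add: gaussian_exp_def fun_eq_iff)
    show "continuous_on strip (\<lambda>z. ?f z n)" for n
    proof (subst continuous_on_cong[OF refl])
      show "?f z n = exp ((z - 1/2)\<^sup>2) * (a n + b n * (z - 1/2) + c n * (z - 1/2)\<^sup>2) * exp (2 * (z - 1/2) * of_real (r n))"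
        if "z \<in> strip" for z using that by (simp add: gaussian_exp_def)
    qed (intro continuous_intros)
    show "(\<lambda>z. ?f z n) holomorphic_on open_strip" for n
    proof (rule holomorphic_transform)
      show "(\<lambda>z. exp ((z - 1/2)\<^sup>2) * (a n + b n * (z - 1/2) + c n * (z - 1/2)\<^sup>2) * exp (2 * (z - 1/2) * of_real (r n))) holomorphic_on open_strip"
        by (intro holomorphic_intros)
    qed (use open_strip_subset in \<open>auto simp: gaussian_exp_def\<close>)
    show "(\<lambda>n. 12 * (q n * exp (- r n) + q n * exp (r n))) \<longlonglongrightarrow> 0"
      by (intro tendsto_mult_right_zero tendsto_add_zero lim summable_LIMSEQ_zero sum)
    show "summable (\<lambda>n. 12 * (q n * exp (r n)))" by (intro summable_mult sum)
    show "cmod (?f z n) \<le> 12 * (q n * exp (- r n) + q n * exp (r n))" if z: "z \<in> strip" for z n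
    proof -
      have "(2 * Re z - 1) * r n \<le> \<bar>r n\<bar>"
      proof -
        have "\<bar>2 * Re z - 1\<bar> \<le> 1" using z by (auto simp: strip_def)
        then have "\<bar>(2 * Re z - 1) * r n\<bar> \<le> 1 * \<bar>r n\<bar>" unfolding abs_mult by (intro mult_right_mono) auto
        then show ?thesis by linarith
      qed
      then have "exp ((2 * Re z - 1) * r n) \<le> exp \<bar>r n\<bar>" by simp
      also have "\<dots> \<le> exp (- r n) + exp (r n)" by (cases "r n \<ge> 0") auto
      finally have "12 * exp (- (Im z)\<^sup>2 / 2) * (q n * exp ((2 * Re z - 1) * r n))
          \<le> 12 * 1 * (q n * (exp (- r n) + exp (r n)))"
        using q0 by (intro mult_mono) auto
      then show ?thesis
        using gaussian_exp_bound[where a = a and b = b and c = c and q = "q n" and n = n and r = r, OF z q]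
        by (simp add: distrib_left)
    qed
    show "cmod (?f (Complex 1 t) n) \<le> 12 * (q n * exp (r n))" for t n
    proof -
      have "12 * exp (- t\<^sup>2 / 2) * (q n * exp (r n)) \<le> 12 * 1 * (q n * exp (r n))"
        using q0 by (intro mult_right_mono) auto
      then show ?thesis using f1n[of t n] by simp
    qed
    have dec: "\<forall>\<^sub>F t in at_infinity. exp (- t\<^sup>2 / 2) * (12 * A) \<le> e" if "e > 0" for e :: real
      using order_tendstoD(2)[OF tendsto_gaussian that, of "12 * A"]
      by eventually_elim (simp add: mult.commute)
    show "unif_null (\<lambda>t. ?f (Complex 0 t)) at_infinity"
      unfolding unif_null_def
    proof (intro allI impI)
      fix e :: real assume "e > 0"
      from dec[OF this] show "\<forall>\<^sub>F t in at_infinity. \<forall>n. cmod (?f (Complex 0 t) n) \<le> e"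
        by eventually_elim (use f0 order_trans in blast)
    qed
    show "sum_null (\<lambda>t. ?f (Complex 1 t)) at_infinity"
      unfolding sum_null_def
    proof (intro allI impI)
      fix e :: real assume "e > 0"
      from dec[OF this] show "\<forall>\<^sub>F t in at_infinity. \<forall>N. (\<Sum>n<N. cmod (?f (Complex 1 t) n)) \<le> e"
        by eventually_elim (use f1 order_trans in blast)
    qed
  qed
  have le: "exp (- t\<^sup>2 / 2) * (12 * A) \<le> 12 * A" for t :: real
    using mult_right_mono[OF gauss_le[of t], of "12 * A"] A by simp
  show "vnorm Calderon ?f \<le> 12 * A"
    by (rule Calderon_norm_le[OF mem]) (use f0 f1 le order_trans in blast)+
qed

text \<open>With \<open>u = z - 1/2\<close> these are the coefficients of the product of
  \<open>1 + u^2\<close>, \<open>a + b * u + c * u^2\<close> and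
  \<open>1 + 2 * r * u + 2 * r^2 * u^2\<close>. Thus \<open>a\<close> prescribes
  \<open>Delta 0\<close>, \<open>b = - 2 * r * a\<close> kills \<open>Delta 1\<close>, and
  \<open>c\<close> corrects \<open>Delta 2\<close>; the summand 1 stems from the Gaussian.\<close>

lemma
  assumes mem: "gaussian_exp a b c r \<in> vecs Calderon"
  shows Delta_0_gaussian_exp: "Delta 0 (gaussian_exp a b c r) n = a n"
    and Delta_1_gaussian_exp: "Delta 1 (gaussian_exp a b c r) n = b n + 2 * of_real (r n) * a n"
    and Delta_2_gaussian_exp: "Delta 2 (gaussian_exp a b c r) n =
      c n + 2 * of_real (r n) * b n + (2 * (of_real (r n))\<^sup>2 + 1) * a n"
proof -
  let ?f = "\<lambda>z. gaussian_exp a b c r z n"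
  define R :: complex where "R = of_real (r n)"
  define g where "g z = exp ((z - 1/2)\<^sup>2) * (a n + b n * (z - 1/2) + c n * (z - 1/2)\<^sup>2) * exp (2 * (z - 1/2) * R)" for z
  define g' where "g' z = exp ((z - 1/2)\<^sup>2) * ((2 * (z - 1/2) + 2 * R) * (a n + b n * (z - 1/2) + c n * (z - 1/2)\<^sup>2)
      + (b n + 2 * c n * (z - 1/2))) * exp (2 * (z - 1/2) * R)" for z
  have fg: "?f z = g z" if "z \<in> open_strip" for z
    using that open_strip_subset by (auto simp: gaussian_exp_def g_def R_def)
  have "(g has_field_derivative g' z) (at z)" for z
  proof -
    have 1: "((\<lambda>z. exp ((z - 1/2)\<^sup>2)) has_field_derivative exp ((z - 1/2)\<^sup>2) * (2 * (z - 1/2))) (at z)"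
      by (auto intro!: derivative_eq_intros)
    have 2: "((\<lambda>z. exp (2 * (z - 1/2) * R)) has_field_derivative exp (2 * (z - 1/2) * R) * (2 * R)) (at z)"
      by (auto intro!: derivative_eq_intros)
    have 3: "((\<lambda>z. a n + b n * (z - 1/2) + c n * (z - 1/2)\<^sup>2) has_field_derivative b n + 2 * c n * (z - 1/2)) (at z)"
      by (auto intro!: derivative_eq_intros)
    have ring: "(e * (2 * u) * p + p' * e) * f + f * (2 * R) * (e * p) = e * ((2 * u + 2 * R) * p + p') * f"
      for e f u p p' :: complex by (simp add: algebra_simps)
    show ?thesis unfolding g_def g'_def
      using DERIV_mult[OF DERIV_mult[OF 1 3] 2] unfolding ring .
  qed
  then have dg: "deriv g = g'" by (simp add: DERIV_imp_deriv fun_eq_iff)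
  have "(g' has_field_derivative 2 * c n + 4 * R * b n + (4 * R\<^sup>2 + 2) * a n) (at (1/2))"
    unfolding g'_def by (auto intro!: derivative_eq_intros simp: algebra_simps power2_eq_square)
  then have dg': "deriv g' (1/2) = 2 * c n + 4 * R * b n + (4 * R\<^sup>2 + 2) * a n" by (rule DERIV_imp_deriv)
  have holg: "g holomorphic_on open_strip" unfolding g_def by (intro holomorphic_intros)
  have eq: "(deriv ^^ k) ?f (1/2) = (deriv ^^ k) g (1/2)" for k
    by (rule higher_deriv_transform_within_open[OF Calderon_holomorphic[OF mem] holg open_open_strip half_in_open_strip fg])
  show "Delta 0 (gaussian_exp a b c r) n = a n"
    using eq[of 0] by (simp add: Delta_eq[OF mem] g_def)
  show "Delta 1 (gaussian_exp a b c r) n = b n + 2 * of_real (r n) * a n"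
    using eq[of 1] by (simp add: Delta_eq[OF mem] dg g'_def R_def)
  show "Delta 2 (gaussian_exp a b c r) n = c n + 2 * of_real (r n) * b n + (2 * (of_real (r n))\<^sup>2 + 1) * a n"
    using eq[of 2] by (simp add: Delta_eq[OF mem] dg dg' numeral_2_eq_2 R_def)
qed

text \<open>The weights are powers of the tails of the series: if \<open>R\<close> denotes a tail then
  \<open>a n / sqrt (R n) \<le> 2 * (sqrt (R n) - sqrt (R (n + 1)))\<close>.\<close>

lemma convergence_factors:
  fixes a :: "nat \<Rightarrow> real"
  assumes a0: "\<And>n. a n \<ge> 0" and a1: "\<And>N. (\<Sum>n<N. a n) \<le> 1"
  obtains k :: "nat \<Rightarrow> real" where "\<And>n. 0 \<le> k n" "\<And>n. k n \<le> 1" "k \<longlonglongrightarrow> 0"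
    "\<And>n. a n \<noteq> 0 \<Longrightarrow> k n > 0" "\<And>N. (\<Sum>n<N. a n / k n ^ 4) \<le> 2"
proof
  have sum: "summable a"
    by (rule bounded_imp_summable[where B = 1])
      (use a0 a1 in \<open>auto simp: lessThan_Suc_atMost[symmetric] simp del: sum.lessThan_Suc\<close>)
  define R where "R n = suminf a - (\<Sum>k<n. a k)" for n
  have RS: "R (Suc n) = R n - a n" for n by (simp add: R_def)
  have R0: "R n \<ge> 0" for n using sum_le_suminf[OF sum, of "{..<n}"] a0 by (simp add: R_def)
  have aR: "a n \<le> R n" for n using R0[of "Suc n"] by (simp add: RS)
  have R1: "R n \<le> 1" for n
    using suminf_le_const[OF sum a1] sum_nonneg[of "{..<n}" a] a0 by (simp add: R_def)
  have Rlim: "R \<longlonglongrightarrow> 0"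
    using tendsto_diff[OF tendsto_const summable_LIMSEQ[OF sum], of "suminf a"] by (simp add: R_def[abs_def])
  \<comment> \<open>The eighth root, so that \<open>k ^ 4\<close> is the telescoping weight
    \<open>sqrt (R n)\<close>. Later weights divide by powers of \<open>k\<close> up to the third,
    and since \<open>k \<le> 1\<close> the fourth power dominates them.\<close>
  let ?k = "\<lambda>n. sqrt (sqrt (sqrt (R n)))"
  have k4: "?k n ^ 4 = sqrt (R n)" for n
  proof -
    have "?k n ^ 4 = ((?k n)\<^sup>2)\<^sup>2" by (simp flip: power_mult)
    then show ?thesis using R0 by simp
  qed
  show "0 \<le> ?k n" "?k n \<le> 1" "a n \<noteq> 0 \<Longrightarrow> ?k n > 0" for n
    using R0[of n] R1[of n] aR[of n] a0[of n] by auto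
  show "?k \<longlonglongrightarrow> 0"
    using tendsto_real_sqrt[OF tendsto_real_sqrt[OF tendsto_real_sqrt[OF Rlim]]] by simp
  have step: "a n / sqrt (R n) \<le> 2 * (sqrt (R n) - sqrt (R (Suc n)))" for n
  proof (cases "R n = 0")
    case True
    then have "a n = 0" using aR[of n] a0[of n] by simp
    then show ?thesis using True by (simp add: RS)
  next
    case False
    then have pos: "sqrt (R n) > 0" using R0[of n] by simp
    have "a n = (sqrt (R n))\<^sup>2 - (sqrt (R (Suc n)))\<^sup>2" using R0[of n] R0[of "Suc n"] by (simp add: RS)
    also have "\<dots> = (sqrt (R n) - sqrt (R (Suc n))) * (sqrt (R n) + sqrt (R (Suc n)))"
      by (simp add: power2_eq_square algebra_simps)
    also have "\<dots> \<le> (sqrt (R n) - sqrt (R (Suc n))) * (2 * sqrt (R n))"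
      using a0[of n] by (intro mult_left_mono) (auto simp: RS)
    finally show ?thesis using pos by (simp add: field_simps)
  qed
  fix N
  have "(\<Sum>n<N. a n / ?k n ^ 4) \<le> (\<Sum>n<N. 2 * (sqrt (R n) - sqrt (R (Suc n))))"
    unfolding k4 by (intro sum_mono step)
  also have "\<dots> = 2 * (sqrt (R 0) - sqrt (R N))"
    unfolding sum_distrib_left[symmetric] by (simp only: sum_lessThan_telescope'[of "\<lambda>n. sqrt (R n)"])
  also have "\<dots> \<le> 2" using R1[of 0] R0[of N] by (smt (verit) real_sqrt_ge_0_iff real_sqrt_le_1_iff)
  finally show "(\<Sum>n<N. a n / ?k n ^ 4) \<le> 2" .
qed

subsection \<open>Functionals on \<open>Wedge\<close>\<close>

lemma image_space_norm_ge:
  assumes "x \<in> T ` K" and "0 \<le> a" and le: "\<And>F. F \<in> K \<Longrightarrow> T F = x \<Longrightarrow> m \<le> a * vnorm X F"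
  shows "m \<le> a * vnorm (image_space T X K) x"
proof (cases "a = 0")
  case True then show ?thesis using assms by auto
next
  case False
  then have a: "a > 0" using assms(2) by simp
  have "m / a \<le> Inf {vnorm X F | F. F \<in> K \<and> T F = x}"
  proof (rule cInf_greatest)
    show "{vnorm X F |F. F \<in> K \<and> T F = x} \<noteq> {}" using assms(1) by auto
    fix y assume "y \<in> {vnorm X F |F. F \<in> K \<and> T F = x}"
    then show "m / a \<le> y" using le a by (auto simp: field_simps)
  qed
  then show ?thesis using a by (simp add: image_space_def field_simps)
qed

lemma image_space_norm_le:
  assumes "F \<in> K" and "\<And>G. G \<in> K \<Longrightarrow> 0 \<le> vnorm X G"
  shows "vnorm (image_space T X K) (T F) \<le> vnorm X F"
proof -
  have "Inf {vnorm X G | G. G \<in> K \<and> T G = T F} \<le> vnorm X F"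
    by (rule cInf_lower) (use assms in \<open>auto intro!: bdd_belowI[of _ 0]\<close>)
  then show ?thesis by (simp add: image_space_def)
qed

lemma vecs_Wedge_iff:
  "v \<in> vecs Wedge \<longleftrightarrow> (\<exists>G\<in>vecs Calderon. Delta 1 G = 0 \<and> v = (Delta 2 G, Delta 0 G))"
  by (auto simp: Wedge_def image_space_def ker_Delta_def Delta_pair_def)

lemma Wedge_norm_le:
  assumes "G \<in> vecs Calderon" "Delta 1 G = 0"
  shows "vnorm Wedge (Delta 2 G, Delta 0 G) \<le> vnorm Calderon G"
  using image_space_norm_le[of G "ker_Delta 1" Calderon "Delta_pair 2 0"] assms Calderon_norm_nonneg
  by (auto simp: Wedge_def ker_Delta_def Delta_pair_def)

lemma Wedge_norm_ge:
  assumes "v \<in> vecs Wedge" "0 \<le> a"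
    and "\<And>G. G \<in> vecs Calderon \<Longrightarrow> Delta 1 G = 0 \<Longrightarrow> v = (Delta 2 G, Delta 0 G) \<Longrightarrow> m \<le> a * vnorm Calderon G"
  shows "m \<le> a * vnorm Wedge v"
  unfolding Wedge_def
  by (rule image_space_norm_ge)
    (use assms in \<open>auto simp: Wedge_def ker_Delta_def Delta_pair_def image_space_def\<close>)

lemma Wedge_norm_nonneg: "v \<in> vecs Wedge \<Longrightarrow> 0 \<le> vnorm Wedge v"
  using Wedge_norm_ge[of v 1 0] Calderon_norm_nonneg by simp

lemma Wedge_add:
  assumes "v \<in> vecs Wedge" "w \<in> vecs Wedge" shows "v + w \<in> vecs Wedge"
proof -
  obtain F where F: "F \<in> vecs Calderon" "Delta 1 F = 0" "v = (Delta 2 F, Delta 0 F)"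
    using assms(1) vecs_Wedge_iff by blast
  obtain G where G: "G \<in> vecs Calderon" "Delta 1 G = 0" "w = (Delta 2 G, Delta 0 G)"
    using assms(2) vecs_Wedge_iff by blast
  show ?thesis unfolding vecs_Wedge_iff
    by (rule bexI[of _ "F + G"]) (simp_all add: F G Calderon_add Delta_add del: One_nat_def)
qed

lemma Wedge_scale:
  assumes "v \<in> vecs Wedge" shows "c *\<^sub>C v \<in> vecs Wedge"
proof -
  obtain F where F: "F \<in> vecs Calderon" "Delta 1 F = 0" "v = (Delta 2 F, Delta 0 F)"
    using assms(1) vecs_Wedge_iff by blast
  have "c *\<^sub>C (0 :: nat \<Rightarrow> complex) = 0" by (simp add: scaleC_fun_def scaleC_complex_def fun_eq_iff)
  then show ?thesis unfolding vecs_Wedge_iff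
    by (intro bexI[of _ "c *\<^sub>C F"]) (simp_all add: F Calderon_scale Delta_scale scaleC_prod_def del: One_nat_def)
qed

section \<open>Finitely supported pairs\<close>

lemma sum_cutoff_le:
  fixes a :: "nat \<Rightarrow> real"
  assumes "\<And>n. a n \<ge> 0"
  shows "(\<Sum>n<M. if n < N then a n else 0) \<le> (\<Sum>n<N. a n)"
proof -
  have "(\<Sum>n<M. if n < N then a n else 0) = (\<Sum>n\<in>{..<M} \<inter> {..<N}. a n)"
    by (simp add: sum.inter_restrict lessThan_def)
  also have "\<dots> \<le> (\<Sum>n<N. a n)" by (rule sum_mono2) (use assms in auto)
  finally show ?thesis .
qed

text \<open>With exponents 0 and no linear term the function is even about 1/2, so its first
  coefficient vanishes; \<open>w - x\<close> in place of \<open>w\<close> compensates the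
  contribution of the Gaussian to the second coefficient.\<close>

lemma Wedge_finite_support:
  assumes "\<And>n. n \<ge> N \<Longrightarrow> w n = 0" "\<And>n. n \<ge> N \<Longrightarrow> x n = 0"
  shows "(w, x) \<in> vecs Wedge"
proof -
  define q where "q n = cmod (x n) + cmod (w n - x n)" for n
  define A where "A = (\<Sum>n<N. q n)"
  have q0: "q n \<ge> 0" for n by (simp add: q_def)
  have qN: "q n = (if n < N then q n else 0)" for n using assms by (simp add: q_def)
  have "(\<Sum>n<M. q n) \<le> A" for M
  proof -
    have "(\<Sum>n<M. q n) = (\<Sum>n<M. if n < N then q n else 0)" by (rule sum.cong[OF refl], rule qN)
    then show ?thesis using sum_cutoff_le[of q N M] q0 by (simp add: A_def)
  qed
  moreover have "q n \<le> A" for n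
    using calculation[of "Suc n"] sum_nonneg[of "{..<n}" q] q0 by simp
  moreover have "q \<longlonglongrightarrow> 0"
    by (rule tendsto_eventually) (use assms in \<open>auto simp: q_def eventually_sequentially intro!: exI[of _ N]\<close>)
  moreover have "cmod (x n) \<le> q n" "cmod (w n - x n) \<le> q n" for n by (simp_all add: q_def)
  ultimately have G: "gaussian_exp x (\<lambda>_. 0) (\<lambda>n. w n - x n) (\<lambda>_. 0) \<in> vecs Calderon"
    by (intro Calderon_gaussian_exp[where q = q and A = A]) (simp_all add: q0)
  show ?thesis unfolding vecs_Wedge_iff
    by (rule bexI[OF _ G])
      (simp add: fun_eq_iff Delta_0_gaussian_exp[OF G] Delta_1_gaussian_exp[OF G] Delta_2_gaussian_exp[OF G]
        del: One_nat_def)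
qed

definition unit_vec :: "nat \<Rightarrow> nat \<Rightarrow> complex" where
  "unit_vec n = (\<lambda>k. of_bool (k = n))"

lemma unit_vec_Wedge: "(unit_vec n, 0) \<in> vecs Wedge" "(0, unit_vec n) \<in> vecs Wedge"
  by (rule Wedge_finite_support[where N = "Suc n"]; simp add: unit_vec_def)+

text \<open>The bound is independent of \<open>n\<close>, so the values
  \<open>\<phi> (0, unit_vec n)\<close> are bounded; for a functional with bound 1/48 they are at
  most 1/4, small enough for the logarithmic equation to have a solution.\<close>

lemma Wedge_norm_unit_vec: "vnorm Wedge (0, unit_vec n) \<le> 12"
proof -
  let ?a = "unit_vec n" and ?c = "\<lambda>k. - unit_vec n k"
  have "(\<Sum>k<N. cmod (unit_vec n k)) \<le> 1" for N
    using sum.delta[of "{..<N}" n "\<lambda>_. 1::real"]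
    by (simp add: unit_vec_def of_bool_def if_distrib cong: if_cong)
  moreover have "(\<lambda>k. cmod (unit_vec n k)) \<longlonglongrightarrow> 0"
    by (rule tendsto_eventually) (auto simp: unit_vec_def eventually_sequentially intro!: exI[of _ "Suc n"])
  moreover have "cmod (unit_vec n k) \<le> 1" for k by (simp add: unit_vec_def)
  ultimately have G: "gaussian_exp ?a (\<lambda>_. 0) ?c (\<lambda>_. 0) \<in> vecs Calderon"
    and le: "vnorm Calderon (gaussian_exp ?a (\<lambda>_. 0) ?c (\<lambda>_. 0)) \<le> 12 * 1"
    by (intro Calderon_gaussian_exp[where q = "\<lambda>k. cmod (unit_vec n k)" and A = 1]
        norm_gaussian_exp[where q = "\<lambda>k. cmod (unit_vec n k)" and A = 1]; simp)+
  have D: "Delta 1 (gaussian_exp ?a (\<lambda>_. 0) ?c (\<lambda>_. 0)) = 0"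
    "(Delta 2 (gaussian_exp ?a (\<lambda>_. 0) ?c (\<lambda>_. 0)), Delta 0 (gaussian_exp ?a (\<lambda>_. 0) ?c (\<lambda>_. 0))) = (0, unit_vec n)"
    by (simp_all add: fun_eq_iff Delta_0_gaussian_exp[OF G] Delta_1_gaussian_exp[OF G] Delta_2_gaussian_exp[OF G]
        del: One_nat_def)
  show ?thesis using Wedge_norm_le[OF G D(1)] le unfolding D(2) by simp
qed

section \<open>Functionals and their values on unit vectors\<close>

definition bounded_functional :: "((nat \<Rightarrow> complex) \<times> (nat \<Rightarrow> complex) \<Rightarrow> complex) \<Rightarrow> real \<Rightarrow> bool" where
  "bounded_functional \<phi> D \<longleftrightarrow> clinear_on (vecs Wedge) \<phi> \<and> 0 \<le> D \<and>
     (\<forall>v\<in>vecs Wedge. cmod (\<phi> v) \<le> D * vnorm Wedge v)"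

lemma bounded_functional_add:
  "bounded_functional \<phi> D \<Longrightarrow> v \<in> vecs Wedge \<Longrightarrow> w \<in> vecs Wedge \<Longrightarrow> \<phi> (v + w) = \<phi> v + \<phi> w"
  by (simp add: bounded_functional_def clinear_on_def)

lemma bounded_functional_scale:
  "bounded_functional \<phi> D \<Longrightarrow> v \<in> vecs Wedge \<Longrightarrow> \<phi> (c *\<^sub>C v) = c * \<phi> v"
  by (simp add: bounded_functional_def clinear_on_def scaleC_complex_def)

lemma bounded_functional_le:
  assumes "bounded_functional \<phi> D" "G \<in> vecs Calderon" "Delta 1 G = 0"
  shows "cmod (\<phi> (Delta 2 G, Delta 0 G)) \<le> D * vnorm Calderon G"
proof -
  have "(Delta 2 G, Delta 0 G) \<in> vecs Wedge" using assms vecs_Wedge_iff by blast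
  then have "cmod (\<phi> (Delta 2 G, Delta 0 G)) \<le> D * vnorm Wedge (Delta 2 G, Delta 0 G)"
    using assms(1) by (simp add: bounded_functional_def)
  also have "\<dots> \<le> D * vnorm Calderon G"
    using Wedge_norm_le[OF assms(2,3)] assms(1) by (intro mult_left_mono) (auto simp: bounded_functional_def)
  finally show ?thesis .
qed

lemma bounded_functional_finite_support:
  assumes \<phi>: "bounded_functional \<phi> D"
  shows "(\<And>n. n \<ge> N \<Longrightarrow> w n = 0) \<Longrightarrow> (\<And>n. n \<ge> N \<Longrightarrow> x n = 0) \<Longrightarrow>
    \<phi> (w, x) = (\<Sum>n<N. w n * \<phi> (unit_vec n, 0) + x n * \<phi> (0, unit_vec n))"
proof (induction N arbitrary: w x)
  case 0
  \<comment> \<open>\<open>clinear_on\<close> speaks of sums and multiples only, so zero is written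
    as a multiple of a unit vector.\<close>
  then have "(w, x) = 0 *\<^sub>C (unit_vec 0, 0)"
    by (simp add: fun_eq_iff scaleC_prod_def scaleC_fun_def scaleC_complex_def)
  then have "\<phi> (w, x) = 0 * \<phi> (unit_vec 0, 0)"
    using bounded_functional_scale[OF \<phi> unit_vec_Wedge(1)] by metis
  then show ?case by simp
next
  case (Suc N)
  let ?w = "restr {..<N} w" and ?x = "restr {..<N} x"
  have *: "\<phi> (?w, ?x) = (\<Sum>n<N. ?w n * \<phi> (unit_vec n, 0) + ?x n * \<phi> (0, unit_vec n))"
    by (rule Suc.IH) (auto simp: restr_def)
  have wx: "(w, x) = (?w, ?x) + (w N *\<^sub>C (unit_vec N, 0) + x N *\<^sub>C (0, unit_vec N))"
    using Suc.prems
    by (auto simp: fun_eq_iff scaleC_prod_def scaleC_fun_def scaleC_complex_def restr_def unit_vec_def not_less le_Suc_eq Suc_le_eq)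
  have mem: "(?w, ?x) \<in> vecs Wedge"
    by (rule Wedge_finite_support[where N = N]) (auto simp: restr_def)
  have "\<phi> (w, x) = \<phi> (?w, ?x) + (w N * \<phi> (unit_vec N, 0) + x N * \<phi> (0, unit_vec N))"
    unfolding wx
    by (simp only: bounded_functional_add[OF \<phi>] bounded_functional_scale[OF \<phi>] mem unit_vec_Wedge Wedge_scale Wedge_add)
  moreover have "\<phi> (?w, ?x) = (\<Sum>n<N. w n * \<phi> (unit_vec n, 0) + x n * \<phi> (0, unit_vec n))"
    unfolding * by (rule sum.cong) (auto simp: restr_def)
  ultimately show ?case by (simp only: sum.lessThan_Suc)
qed

lemma bounded_functional_diff:
  assumes "bounded_functional \<phi> D" "bounded_functional \<psi> E"
  shows "bounded_functional (\<lambda>v. \<phi> v - \<psi> v) (D + E)"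
proof -
  have "cmod (\<phi> v - \<psi> v) \<le> (D + E) * vnorm Wedge v" if "v \<in> vecs Wedge" for v
    using assms that norm_triangle_ineq4[of "\<phi> v" "\<psi> v"]
    by (fastforce simp: bounded_functional_def distrib_right)
  then show ?thesis using assms
    by (auto simp: bounded_functional_def clinear_on_def scaleC_complex_def algebra_simps)
qed

lemma bounded_functional_mult:
  assumes "bounded_functional \<phi> D" "0 \<le> c"
  shows "bounded_functional (\<lambda>v. of_real c * \<phi> v) (c * D)"
proof -
  have "cmod (of_real c * \<phi> v) \<le> c * D * vnorm Wedge v" if "v \<in> vecs Wedge" for v
    using assms that mult_left_mono[of "cmod (\<phi> v)" "D * vnorm Wedge v" c]
    by (simp add: bounded_functional_def norm_mult mult.assoc)
  then show ?thesis using assms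
    by (simp add: bounded_functional_def clinear_on_def scaleC_complex_def algebra_simps)
qed

text \<open>Finitely supported pairs are dense in \<open>Wedge\<close>.\<close>

lemma bounded_functional_zero:
  assumes \<phi>: "bounded_functional \<phi> D"
    and z: "\<And>n. \<phi> (unit_vec n, 0) = 0" "\<And>n. \<phi> (0, unit_vec n) = 0" and v: "v \<in> vecs Wedge"
  shows "\<phi> v = 0"
proof -
  obtain G where G: "G \<in> vecs Calderon" "Delta 1 G = 0" "v = (Delta 2 G, Delta 0 G)"
    using v vecs_Wedge_iff by blast
  have D: "D \<ge> 0" using \<phi> by (simp add: bounded_functional_def)
  have "cmod (\<phi> v) \<le> 0 + e" if e: "e > 0" for e
  proof -
    define d where "d = e / (D + 1)"
    have d: "d > 0" using e D by (simp add: d_def)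
    obtain N where N: "vnorm Calderon (\<lambda>z. restr {N..} (G z)) \<le> d"
      using Calderon_tail[OF G(1) d] by blast
    let ?H = "\<lambda>A z. restr A (G z)"
    have H: "?H A \<in> vecs Calderon" and H1: "Delta 1 (?H A) = 0" for A
      using G
      by (simp_all add: Calderon_restr Delta_restr del: One_nat_def) (simp add: restr_def fun_eq_iff)
    let ?v = "\<lambda>A. (Delta 2 (?H A), Delta 0 (?H A))"
    have mem: "?v A \<in> vecs Wedge" for A using H H1 vecs_Wedge_iff by blast
    have "v = ?v {..<N} + ?v {N..}"
      unfolding G(3) Delta_restr[OF G(1)] by (auto simp: fun_eq_iff restr_def)
    then have "\<phi> v = \<phi> (?v {..<N}) + \<phi> (?v {N..})"
      using bounded_functional_add[OF \<phi> mem mem] by metis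
    also have "\<phi> (?v {..<N}) = (\<Sum>n<N. Delta 2 (?H {..<N}) n * \<phi> (unit_vec n, 0) + Delta 0 (?H {..<N}) n * \<phi> (0, unit_vec n))"
      unfolding Delta_restr[OF G(1)]
      by (rule bounded_functional_finite_support[OF \<phi>]) (simp_all add: restr_def)
    also have "\<dots> = 0" by (simp add: z)
    finally have "cmod (\<phi> v) \<le> D * vnorm Calderon (?H {N..})"
      using bounded_functional_le[OF \<phi> H H1, of "{N..}"] by simp
    also have "\<dots> \<le> (D + 1) * d" using N D d by (intro mult_mono) (auto simp: Calderon_norm_nonneg H)
    finally show ?thesis using D by (simp add: d_def)
  qed
  then have "cmod (\<phi> v) \<le> 0" by (rule field_le_epsilon)
  then show ?thesis by simp
qed

section \<open>The duality pairing\<close>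

text \<open>The entries are paired crosswise because \<open>Delta 2\<close> meets
  \<open>Delta 0\<close> in the product rule; the value 0 off \<open>Wedge\<close> matches
  \<open>dual\<close>.\<close>

definition pairing :: "(nat \<Rightarrow> complex) \<times> (nat \<Rightarrow> complex) \<Rightarrow> (nat \<Rightarrow> complex) \<times> (nat \<Rightarrow> complex) \<Rightarrow> complex" where
  "pairing p v = (if v \<in> vecs Wedge then \<Sum>n. fst p n * snd v n + snd p n * fst v n else 0)"

text \<open>The estimate holds for every \<open>G\<close> representing \<open>v\<close>, the mixed
  term being gone because \<open>Delta 1 G = 0\<close>; the infimum over \<open>G\<close> replaces
  its norm by that of \<open>v\<close>.\<close>

lemma
  assumes F: "F \<in> vecs Calderon" and v: "v \<in> vecs Wedge"
  shows summable_pairing: "summable (\<lambda>n. Delta 2 F n * snd v n + Delta 0 F n * fst v n)"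
    and pairing_le: "cmod (pairing (Delta 2 F, Delta 0 F) v) \<le> 4 * vnorm Calderon F * vnorm Wedge v"
proof -
  let ?g = "\<lambda>n. Delta 2 F n * snd v n + Delta 0 F n * fst v n"
  have bd: "(\<Sum>n<N. cmod (?g n)) \<le> 4 * vnorm Calderon F * vnorm Calderon G"
    if "G \<in> vecs Calderon" "Delta 1 G = 0" "v = (Delta 2 G, Delta 0 G)" for G N
    using pairing_bound[OF F that(1), of N] that by simp
  obtain G where G: "G \<in> vecs Calderon" "Delta 1 G = 0" "v = (Delta 2 G, Delta 0 G)"
    using v vecs_Wedge_iff by blast
  have sn: "summable (\<lambda>n. cmod (?g n))"
    by (rule bounded_imp_summable[where B = "4 * vnorm Calderon F * vnorm Calderon G"])
      (use bd[OF G] in \<open>auto simp: lessThan_Suc_atMost[symmetric] simp del: sum.lessThan_Suc\<close>)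
  then show "summable ?g" by (rule summable_norm_cancel)
  have "cmod (pairing (Delta 2 F, Delta 0 F) v) \<le> 4 * vnorm Calderon F * vnorm Calderon G"
    if "G \<in> vecs Calderon" "Delta 1 G = 0" "v = (Delta 2 G, Delta 0 G)" for G
    using summable_norm[OF sn] suminf_le_const[OF sn bd[OF that]] v by (simp add: pairing_def)
  then show "cmod (pairing (Delta 2 F, Delta 0 F) v) \<le> 4 * vnorm Calderon F * vnorm Wedge v"
    using Calderon_norm_nonneg[OF F] by (intro Wedge_norm_ge[OF v]) auto
qed

lemma bounded_functional_pairing:
  assumes F: "F \<in> vecs Calderon"
  shows "bounded_functional (pairing (Delta 2 F, Delta 0 F)) (4 * vnorm Calderon F)"
  unfolding bounded_functional_def clinear_on_def
proof (intro conjI ballI allI)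
  show "0 \<le> 4 * vnorm Calderon F" using Calderon_norm_nonneg[OF F] by simp
  show "cmod (pairing (Delta 2 F, Delta 0 F) v) \<le> 4 * vnorm Calderon F * vnorm Wedge v"
    if "v \<in> vecs Wedge" for v by (rule pairing_le[OF F that])
  show "pairing (Delta 2 F, Delta 0 F) (v + w) = pairing (Delta 2 F, Delta 0 F) v + pairing (Delta 2 F, Delta 0 F) w"
    if "v \<in> vecs Wedge" "w \<in> vecs Wedge" for v w
    using suminf_add[OF summable_pairing[OF F that(1)] summable_pairing[OF F that(2)]] that
    by (simp add: pairing_def Wedge_add algebra_simps)
  show "pairing (Delta 2 F, Delta 0 F) (c *\<^sub>C v) = c *\<^sub>C pairing (Delta 2 F, Delta 0 F) v"
    if "v \<in> vecs Wedge" for c v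
  proof -
    have "fst (c *\<^sub>C v) n = c * fst v n" "snd (c *\<^sub>C v) n = c * snd v n" for n
      by (simp_all add: scaleC_prod_def scaleC_fun_def scaleC_complex_def)
    then show ?thesis
      using suminf_mult[OF summable_pairing[OF F that], of c] Wedge_scale[OF that, of c] that
      by (simp add: pairing_def scaleC_complex_def algebra_simps)
  qed
qed

text \<open>Values on unit vectors recover \<open>p\<close>. This yields injectivity and shows which
  coefficients a representing function must have.\<close>

lemma pairing_unit_vec:
  "pairing p (unit_vec n, 0) = snd p n" "pairing p (0, unit_vec n) = fst p n"
proof -
  have "(\<Sum>k. f k * unit_vec n k) = f n" for f :: "nat \<Rightarrow> complex"
    using sums_unique[OF sums_single[of n f]] by (simp add: unit_vec_def of_bool_def if_distrib cong: if_cong)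
  then show "pairing p (unit_vec n, 0) = snd p n" "pairing p (0, unit_vec n) = fst p n"
    by (simp_all add: pairing_def unit_vec_Wedge)
qed

text \<open>Testing against \<open>cnj (x n)\<close> for \<open>n < N\<close> bounds the partial sums \<open>S\<close> of \<open>\<bar>x n\<bar>\<^sup>2\<close> by a small
  multiple of \<open>max 1 S\<close>, so that no homogeneity argument is needed.\<close>

lemma functional_second_coordinate_small:
  assumes \<phi>: "bounded_functional \<phi> (1/48)"
  shows "\<exists>F\<in>vecs Calderon. vnorm Calderon F \<le> 24 \<and> (\<forall>n. Delta 0 F n = \<phi> (unit_vec n, 0))"
proof -
  define x where "x n = \<phi> (unit_vec n, 0)" for n
  \<comment> \<open>The unperturbed exponent is admissible here because the test sequence
    \<open>c\<close> below is finitely supported.\<close>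
  define r where "r n = ln (cmod (x n))" for n
  have er: "exp (r n) = cmod (x n)" if "x n \<noteq> 0" for n using that by (simp add: r_def)
  have S1: "(\<Sum>n<N. (cmod (x n))\<^sup>2) \<le> 1" for N
  proof -
    define S where "S = (\<Sum>n<N. (cmod (x n))\<^sup>2)"
    define c where "c n = (if n < N then cnj (x n) else 0)" for n
    have q1: "cmod (c n) * exp (- r n) \<le> 1" for n
      using er[of n] by (cases "x n = 0") (auto simp: c_def exp_minus)
    have q2: "cmod (c n) * exp (r n) = (if n < N then (cmod (x n))\<^sup>2 else 0)" for n
      using er[of n] by (cases "x n = 0") (auto simp: c_def power2_eq_square)
    have lim: "(\<lambda>n. cmod (c n) * exp (- r n)) \<longlonglongrightarrow> 0"
      by (rule tendsto_eventually) (auto simp: c_def eventually_sequentially intro!: exI[of _ N])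
    have A0: "cmod (c n) * exp (- r n) \<le> max 1 S" for n using q1[of n] by simp
    have A1: "(\<Sum>n<M. cmod (c n) * exp (r n)) \<le> max 1 S" for M
      unfolding q2 using sum_cutoff_le[of "\<lambda>n. (cmod (x n))\<^sup>2" N M] by (simp add: S_def)
    let ?G = "gaussian_exp (\<lambda>_. 0) (\<lambda>_. 0) c r"
    have G: "?G \<in> vecs Calderon"
      by (rule Calderon_gaussian_exp[OF _ _ _ lim A0 A1]) auto
    have nG: "vnorm Calderon ?G \<le> 12 * max 1 S"
      by (rule norm_gaussian_exp[OF _ _ _ lim A0 A1]) auto
    have D: "Delta 0 ?G = 0" "Delta 1 ?G = 0" "Delta 2 ?G = c"
      by (simp_all add: fun_eq_iff Delta_0_gaussian_exp[OF G] Delta_1_gaussian_exp[OF G]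
          Delta_2_gaussian_exp[OF G] del: One_nat_def)
    have "\<phi> (c, 0) = (\<Sum>n<N. c n * \<phi> (unit_vec n, 0) + 0 n * \<phi> (0, unit_vec n))"
      by (rule bounded_functional_finite_support[OF \<phi>]) (auto simp: c_def)
    also have "\<dots> = (\<Sum>n<N. of_real ((cmod (x n))\<^sup>2))"
      by (rule sum.cong) (simp_all only: complex_norm_square, simp_all add: c_def x_def mult.commute)
    also have "\<dots> = of_real S" by (simp add: S_def)
    finally have "cmod (\<phi> (c, 0)) = \<bar>S\<bar>" by (simp only: norm_of_real)
    then have "S \<le> 1/48 * vnorm Calderon ?G"
      using bounded_functional_le[OF \<phi> G D(2)] D by simp
    then show ?thesis using nG by (simp add: S_def[symmetric])
  qed
  obtain k where k: "\<And>n. 0 \<le> k n" "\<And>n. k n \<le> 1" "k \<longlonglongrightarrow> 0"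
    "\<And>n. (cmod (x n))\<^sup>2 \<noteq> 0 \<Longrightarrow> k n > 0" "\<And>N. (\<Sum>n<N. (cmod (x n))\<^sup>2 / k n ^ 4) \<le> 2"
    using convergence_factors[of "\<lambda>n. (cmod (x n))\<^sup>2"] S1 by auto
  \<comment> \<open>The exponent exceeds \<open>ln \<bar>x n\<bar>\<close> by
    \<open>2 * ln (1 / k n)\<close>. On the left line the weight becomes \<open>k\<^sup>2\<close>,
    which is null; on the right line it becomes \<open>\<bar>x\<bar>\<^sup>2 / k\<^sup>2\<close>,
    which is still summable.\<close>
  define s where "s n = ln (cmod (x n) / (k n)\<^sup>2)" for n
  have es: "exp (s n) = cmod (x n) / (k n)\<^sup>2" if "x n \<noteq> 0" for n
    using that k(4)[of n] by (simp add: s_def)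
  have q1: "cmod (x n) * exp (- s n) \<le> (k n)\<^sup>2" for n
    using es[of n] by (cases "x n = 0") (auto simp: exp_minus)
  have k2: "(k n)\<^sup>2 \<le> 1" for n using k(1,2) by (simp add: power_le_one)
  have q2: "cmod (x n) * exp (s n) \<le> (cmod (x n))\<^sup>2 / k n ^ 4" for n
  proof (cases "x n = 0")
    case False
    then have kn: "k n > 0" using k(4)[of n] by simp
    have "k n ^ 4 \<le> (k n)\<^sup>2" using k(1,2) by (intro power_decreasing) auto
    then have "(cmod (x n))\<^sup>2 / (k n)\<^sup>2 \<le> (cmod (x n))\<^sup>2 / k n ^ 4"
      using kn by (intro divide_left_mono) auto
    then show ?thesis using es[OF False] by (simp add: power2_eq_square)
  qed simp
  have lim: "(\<lambda>n. cmod (x n) * exp (- s n)) \<longlonglongrightarrow> 0"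
  proof (rule tendsto_sandwich[where f = "\<lambda>_. 0" and h = "\<lambda>n. (k n)\<^sup>2"])
    show "\<forall>\<^sub>F n in sequentially. cmod (x n) * exp (- s n) \<le> (k n)\<^sup>2" by (rule always_eventually) (use q1 in blast)
    show "(\<lambda>n. (k n)\<^sup>2) \<longlonglongrightarrow> 0" using tendsto_power[OF k(3), of 2] by simp
  qed auto
  have A0: "cmod (x n) * exp (- s n) \<le> 2" for n using q1[of n] k2[of n] by linarith
  have A1: "(\<Sum>n<N. cmod (x n) * exp (s n)) \<le> 2" for N
    using sum_mono[of "{..<N}", OF q2] k(5)[of N] by (rule order_trans)
  let ?F = "gaussian_exp x (\<lambda>_. 0) (\<lambda>_. 0) s"
  have F: "?F \<in> vecs Calderon" by (rule Calderon_gaussian_exp[OF _ _ _ lim A0 A1]) auto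
  have "vnorm Calderon ?F \<le> 12 * 2" by (rule norm_gaussian_exp[OF _ _ _ lim A0 A1]) auto
  then show ?thesis using F by (intro bexI[of _ ?F]) (auto simp: Delta_0_gaussian_exp x_def)
qed

text \<open>\<open>L * exp (- L)\<close> equals \<open>exp (-1)\<close> at 1 and tends to 0, so the
  intermediate value theorem applies. With \<open>s = exp (- L)\<close> this inverts
  \<open>s * ln (1 / s)\<close>; \<open>L \<ge> 1\<close> selects the branch of small
  \<open>s\<close> and permits division by \<open>L\<close>.\<close>

lemma exists_log_parameter:
  assumes "0 < p" "p \<le> exp (-1)"
  shows "\<exists>L\<ge>1. L * exp (- L) = (p :: real)"
proof -
  have "((\<lambda>L::real. L * exp (- L)) \<longlongrightarrow> 0) at_top" by real_asymp
  then have "\<forall>\<^sub>F L in at_top. L * exp (- L) < p" using assms(1) by (rule order_tendstoD(2))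
  moreover have "\<forall>\<^sub>F L in at_top. L \<ge> (1::real)" by (rule eventually_ge_at_top)
  ultimately have "\<forall>\<^sub>F L in at_top. L * exp (- L) < p \<and> L \<ge> 1" by eventually_elim auto
  then obtain b :: real where b: "b * exp (- b) < p" "b \<ge> 1"
    using eventually_happens'[OF trivial_limit_at_top_linorder] by blast
  have "\<exists>L\<ge>1. L \<le> b \<and> L * exp (- L) = p"
  proof (rule IVT2')
    show "b * exp (- b) \<le> p" "p \<le> 1 * exp (- 1)" "1 \<le> b" using b assms by auto
    show "continuous_on {1..b} (\<lambda>L::real. L * exp (- L))" by (intro continuous_intros)
  qed
  then show ?thesis by blast
qed

text \<open>A functional killing the first coordinate is represented by \<open>\<psi> n = s * L * sgn (\<psi> n)\<close> with
  \<open>s = exp (-L)\<close>. The test sequence \<open>s / L\<close> lies in the domain of the Kalton--Peck map, which takes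
  it to a multiple of \<open>s\<close>; this bounds \<open>\<Sum> s\<^sup>2\<close>.\<close>

lemma functional_first_coordinate_small:
  assumes \<phi>: "bounded_functional \<phi> (1/48)" and z: "\<And>n. \<phi> (unit_vec n, 0) = 0"
  shows "\<exists>F\<in>vecs Calderon. vnorm Calderon F \<le> 48 \<and> Delta 0 F = 0 \<and> (\<forall>n. Delta 2 F n = \<phi> (0, unit_vec n))"
proof -
  define p where "p n = \<phi> (0, unit_vec n)" for n
  have p_small: "cmod (p n) \<le> exp (-1)" for n
  proof -
    have "cmod (p n) \<le> 1/48 * vnorm Wedge (0, unit_vec n)"
      using \<phi> unit_vec_Wedge unfolding p_def bounded_functional_def by blast
    also have "\<dots> \<le> 1/4" using Wedge_norm_unit_vec[of n] by simp
    also have "\<dots> \<le> exp (-1::real)" using exp_le by (simp add: exp_minus field_simps)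
    finally show ?thesis .
  qed
  have "\<exists>L\<ge>1. p n \<noteq> 0 \<longrightarrow> L * exp (- L) = cmod (p n)" for n
  proof (cases "p n = 0")
    case False then show ?thesis using exists_log_parameter[of "cmod (p n)"] p_small by auto
  qed auto
  then obtain L where L: "\<And>n. L n \<ge> 1" "\<And>n. p n \<noteq> 0 \<Longrightarrow> L n * exp (- L n) = cmod (p n)"
    by metis
  \<comment> \<open>Where \<open>p n = 0\<close> the parameter \<open>L n\<close> is arbitrary, so
    \<open>s n\<close> is set to 0 there.\<close>
  define s where "s n = (if p n = 0 then 0 else exp (- L n))" for n
  have s0: "s n \<ge> 0" and sL: "s n * L n = cmod (p n)" and s_exp: "s n \<noteq> 0 \<Longrightarrow> exp (- L n) = s n" for n
    using L(2)[of n] by (auto simp: s_def mult.commute)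
  have S1: "(\<Sum>n<N. (s n)\<^sup>2) \<le> 1" for N
  proof -
    define S where "S = (\<Sum>n<N. (s n)\<^sup>2)"
    \<comment> \<open>The test function has exponent \<open>- L\<close>, and
      \<open>b = 2 * L * a\<close> cancels its first coefficient. Its second coefficient contributes
      nothing, because \<open>\<phi>\<close> vanishes on the vectors \<open>(unit_vec n, 0)\<close>.
      The phase makes \<open>a n * p n\<close> equal to \<open>(s n)\<^sup>2\<close>.\<close>
    define a where "a n = (if n < N then of_real (s n / L n) * cnj (sgn (p n)) else 0)" for n
    define b where "b n = (if n < N then of_real (2 * s n) * cnj (sgn (p n)) else 0)" for n
    define q where "q n = (if n < N then 2 * s n else 0)" for n
    have qa: "cmod (a n) \<le> q n" for n
    proof -
      have "s n / L n \<le> s n / 1" using L(1)[of n] s0[of n] by (intro divide_left_mono) auto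
      then have "s n / L n \<le> 2 * s n" using s0[of n] by simp
      moreover have "cmod (sgn (p n)) \<le> 1" by (simp add: norm_sgn)
      ultimately have "\<bar>s n / L n\<bar> * cmod (sgn (p n)) \<le> 2 * s n * 1"
        using s0[of n] L(1)[of n] by (intro mult_mono) auto
      then show ?thesis by (simp add: a_def q_def norm_mult norm_divide)
    qed
    have qb: "cmod (b n) \<le> q n" for n
      using s0[of n] by (auto simp: b_def q_def norm_mult norm_sgn)
    have q0: "cmod 0 \<le> q n" for n using s0[of n] by (simp add: q_def)
    have q1: "q n * exp (- (- L n)) \<le> 2" for n
    proof (cases "s n = 0")
      case False
      then show ?thesis using s_exp[OF False, symmetric] by (simp add: q_def flip: exp_add)
    qed (simp add: q_def)
    have q2: "q n * exp (- L n) = (if n < N then 2 * (s n)\<^sup>2 else 0)" for n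
      using s_exp[of n] by (cases "s n = 0") (auto simp: q_def power2_eq_square)
    have lim: "(\<lambda>n. q n * exp (- (- L n))) \<longlonglongrightarrow> 0"
      by (rule tendsto_eventually) (auto simp: q_def eventually_sequentially intro!: exI[of _ N])
    have A0: "q n * exp (- (- L n)) \<le> 2 * max 1 S" for n using q1[of n] by simp
    have A1: "(\<Sum>n<M. q n * exp (- L n)) \<le> 2 * max 1 S" for M
      unfolding q2 using sum_cutoff_le[of "\<lambda>n. 2 * (s n)\<^sup>2" N M]
      by (simp add: S_def flip: sum_distrib_left)
    let ?G = "gaussian_exp a b (\<lambda>_. 0) (\<lambda>n. - L n)"
    have G: "?G \<in> vecs Calderon"
      by (rule Calderon_gaussian_exp[OF qa qb q0 lim A0 A1])
    have nG: "vnorm Calderon ?G \<le> 12 * (2 * max 1 S)"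
      by (rule norm_gaussian_exp[OF qa qb q0 lim A0 A1])
    have ba: "b n = 2 * of_real (L n) * a n" for n using L(1)[of n] by (auto simp: a_def b_def)
    have D: "Delta 0 ?G = a" "Delta 1 ?G = 0"
      by (simp_all add: fun_eq_iff Delta_0_gaussian_exp[OF G] Delta_1_gaussian_exp[OF G] ba del: One_nat_def)
    have D2: "Delta 2 ?G n = 0" if "n \<ge> N" for n
      using that by (simp add: Delta_2_gaussian_exp[OF G] a_def b_def)
    have "\<phi> (Delta 2 ?G, a) = (\<Sum>n<N. Delta 2 ?G n * \<phi> (unit_vec n, 0) + a n * \<phi> (0, unit_vec n))"
      by (rule bounded_functional_finite_support[OF \<phi>]) (auto simp: a_def D2)
    also have "\<dots> = (\<Sum>n<N. of_real ((s n)\<^sup>2))"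
    proof (rule sum.cong[OF refl])
      fix n assume n: "n \<in> {..<N}"
      have "cnj (sgn (p n)) * p n = of_real (cmod (p n))"
      proof -
        have "cnj (sgn (p n)) * p n = p n * cnj (p n) / of_real (cmod (p n))" by (simp add: sgn_eq)
        also have "\<dots> = of_real ((cmod (p n))\<^sup>2) / of_real (cmod (p n))" by (simp only: complex_norm_square)
        finally show ?thesis by (simp add: power2_eq_square)
      qed
      then have "a n * p n = of_real (s n / L n * cmod (p n))" using n by (simp add: a_def)
      also have "s n / L n * cmod (p n) = (s n)\<^sup>2"
        using L(1)[of n] by (simp add: sL[symmetric] power2_eq_square)
      finally show "Delta 2 ?G n * \<phi> (unit_vec n, 0) + a n * \<phi> (0, unit_vec n) = of_real ((s n)\<^sup>2)"
        by (simp add: z p_def)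
    qed
    also have "\<dots> = of_real S" by (simp add: S_def)
    finally have "cmod (\<phi> (Delta 2 ?G, a)) = \<bar>S\<bar>" by (simp only: norm_of_real)
    then have "S \<le> 1/48 * vnorm Calderon ?G"
      using bounded_functional_le[OF \<phi> G D(2)] D by simp
    then show ?thesis using nG by (simp add: S_def[symmetric])
  qed
  obtain k where k: "\<And>n. 0 \<le> k n" "\<And>n. k n \<le> 1" "k \<longlonglongrightarrow> 0"
    "\<And>n. (s n)\<^sup>2 \<noteq> 0 \<Longrightarrow> k n > 0" "\<And>N. (\<Sum>n<N. (s n)\<^sup>2 / k n ^ 4) \<le> 2"
    using convergence_factors[of "\<lambda>n. (s n)\<^sup>2"] S1 by auto
  \<comment> \<open>The function will have \<open>a = 0\<close>, so its \<open>Delta 2\<close> is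
    \<open>c + 2 * r * b\<close>. The choice of \<open>b\<close> gives
    \<open>(L + 2 * ln k) * s * sgn p\<close>, and \<open>c\<close> removes the part with
    \<open>ln k\<close>, leaving \<open>s * L * sgn p = p\<close>.\<close>
  define r where "r n = - L n - 2 * ln (k n)" for n
  define b where "b n = - of_real (s n / 2) * sgn (p n)" for n
  define c where "c n = - of_real (2 * ln (k n) * s n) * sgn (p n)" for n
  \<comment> \<open>Since \<open>\<bar>ln k\<bar> \<le> 1 / k\<close>, the correction
    \<open>c\<close> costs one power of \<open>k\<close>. The exponent was shifted so that
    \<open>exp r = s / k\<^sup>2\<close>, which leaves one power to spare: the weights are
    \<open>2 * k\<close> on the left line and \<open>2 * s\<^sup>2 / k ^ 3\<close> on the
    right.\<close>
  define q where "q n = 2 * s n / k n" for n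
  have er: "exp (r n) = s n / (k n)\<^sup>2" if "s n \<noteq> 0" for n
  proof -
    have "exp (r n) = exp (- L n) / (exp (ln (k n)))\<^sup>2"
      by (simp add: r_def exp_diff flip: exp_double)
    then show ?thesis using k(4)[of n] that s_exp[OF that] by simp
  qed
  have nsgn: "cmod (sgn (p n)) \<le> 1" for n by (simp add: norm_sgn)
  have qb: "cmod (b n) \<le> q n" for n
  proof (cases "s n = 0")
    case False
    then have kn: "k n > 0" using k(4)[of n] by simp
    have "cmod (b n) \<le> s n / 2"
      using s0[of n] nsgn[of n] by (simp add: b_def norm_mult mult_left_le)
    also have "\<dots> \<le> 2 * s n" using s0[of n] by simp
    also have "2 * s n \<le> 2 * s n / k n"
      using kn k(2)[of n] s0[of n] by (simp add: field_simps mult_left_le_one_le)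
    finally show ?thesis by (simp add: q_def)
  qed (simp add: b_def q_def)
  have qc: "cmod (c n) \<le> q n" for n
  proof (cases "s n = 0")
    case False
    then have kn: "k n > 0" using k(4)[of n] by simp
    have "\<bar>ln (k n)\<bar> = ln (1 / k n)" using kn k(2)[of n] by (simp add: ln_div)
    also have "\<dots> \<le> 1 / k n" using kn ln_le_minus_one[of "1 / k n"] by simp
    finally have "2 * \<bar>ln (k n)\<bar> * s n \<le> 2 * (1 / k n) * s n"
      using s0[of n] by (intro mult_right_mono) auto
    moreover have "cmod (c n) \<le> 2 * \<bar>ln (k n)\<bar> * s n"
      using s0[of n] nsgn[of n] by (simp add: c_def norm_mult abs_mult mult_left_le)
    ultimately show ?thesis by (simp add: q_def)
  qed (simp add: c_def q_def)
  have q0: "cmod 0 \<le> q n" for n using s0[of n] k(1)[of n] by (simp add: q_def)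
  have q1: "q n * exp (- r n) \<le> 2 * k n" for n
  proof (cases "s n = 0")
    case False
    then have "k n > 0" using k(4)[of n] by simp
    then show ?thesis using er[OF False] False by (simp add: q_def exp_minus power2_eq_square)
  qed (simp add: q_def k(1))
  have q2: "q n * exp (r n) \<le> 2 * ((s n)\<^sup>2 / k n ^ 4)" for n
  proof (cases "s n = 0")
    case False
    then have kn: "k n > 0" using k(4)[of n] by simp
    have "q n * exp (r n) = 2 * ((s n)\<^sup>2 / k n ^ 3)"
      unfolding er[OF False] by (simp add: q_def power2_eq_square power3_eq_cube)
    also have "k n ^ 4 \<le> k n ^ 3" using k(1,2) by (intro power_decreasing) auto
    then have "2 * ((s n)\<^sup>2 / k n ^ 3) \<le> 2 * ((s n)\<^sup>2 / k n ^ 4)"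
      using kn by (intro mult_left_mono divide_left_mono) auto
    finally show ?thesis .
  qed (simp add: q_def)
  have lim: "(\<lambda>n. q n * exp (- r n)) \<longlonglongrightarrow> 0"
  proof (rule tendsto_sandwich[where f = "\<lambda>_. 0" and h = "\<lambda>n. 2 * k n"])
    show "\<forall>\<^sub>F n in sequentially. q n * exp (- r n) \<le> 2 * k n" by (rule always_eventually) (use q1 in blast)
    show "(\<lambda>n. 2 * k n) \<longlonglongrightarrow> 0" using tendsto_mult_left[OF k(3), of 2] by simp
    show "\<forall>\<^sub>F n in sequentially. 0 \<le> q n * exp (- r n)" using q0 by (intro always_eventually) simp
  qed auto
  have A0: "q n * exp (- r n) \<le> 4" for n using q1[of n] k(2)[of n] by linarith
  have A1: "(\<Sum>n<N. q n * exp (r n)) \<le> 4" for N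
  proof -
    have "(\<Sum>n<N. q n * exp (r n)) \<le> (\<Sum>n<N. 2 * ((s n)\<^sup>2 / k n ^ 4))" by (intro sum_mono q2)
    also have "\<dots> = 2 * (\<Sum>n<N. (s n)\<^sup>2 / k n ^ 4)" by (simp only: sum_distrib_left)
    finally show ?thesis using k(5)[of N] by linarith
  qed
  let ?F = "gaussian_exp (\<lambda>_. 0) b c r"
  have F: "?F \<in> vecs Calderon" by (rule Calderon_gaussian_exp[OF q0 qb qc lim A0 A1])
  have nF: "vnorm Calderon ?F \<le> 12 * 4" by (rule norm_gaussian_exp[OF q0 qb qc lim A0 A1])
  have "Delta 2 ?F n = p n" for n
  proof -
    have "Delta 2 ?F n = of_real (s n * L n) * sgn (p n)"
      by (simp add: Delta_2_gaussian_exp[OF F] b_def c_def r_def algebra_simps)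
    also have "\<dots> = p n" by (simp add: sL sgn_eq)
    finally show ?thesis .
  qed
  then show ?thesis using F nF
    by (intro bexI[of _ ?F]) (auto simp: Delta_0_gaussian_exp[OF F] p_def fun_eq_iff)
qed

section \<open>Representation of arbitrary functionals\<close>

lemma scaleC_seq: "(c *\<^sub>C x) n = c * x n" for x :: "nat \<Rightarrow> complex"
  by (simp add: scaleC_fun_def scaleC_complex_def)

text \<open>The normalised case is scaled by \<open>48 * D\<close>, whence 1152 = 48 * 24; the
  companion for the first coordinate has 2304 = 48 * 48.\<close>

lemma functional_second_coordinate:
  assumes \<phi>: "bounded_functional \<phi> D" and D: "D > 0"
  shows "\<exists>F\<in>vecs Calderon. vnorm Calderon F \<le> 1152 * D \<and> (\<forall>n. Delta 0 F n = \<phi> (unit_vec n, 0))"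
proof -
  have "bounded_functional (\<lambda>v. of_real (1 / (48 * D)) * \<phi> v) (1 / (48 * D) * D)"
    by (rule bounded_functional_mult[OF \<phi>]) (use D in simp)
  then have "bounded_functional (\<lambda>v. of_real (1 / (48 * D)) * \<phi> v) (1/48)" using D by simp
  from functional_second_coordinate_small[OF this] obtain F where F: "F \<in> vecs Calderon"
    "vnorm Calderon F \<le> 24" "\<And>n. Delta 0 F n = of_real (1 / (48 * D)) * \<phi> (unit_vec n, 0)" by blast
  show ?thesis
  proof (intro bexI conjI allI)
    let ?F = "of_real (48 * D) *\<^sub>C F"
    show "?F \<in> vecs Calderon" by (rule Calderon_scale[OF F(1)])
    have "vnorm Calderon ?F \<le> 48 * D * vnorm Calderon F"
      using Calderon_norm_scale[OF F(1), of "of_real (48 * D)"] D by (simp add: norm_mult)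
    also have "\<dots> \<le> 48 * D * 24" using D F(2) by (intro mult_left_mono) auto
    finally show "vnorm Calderon ?F \<le> 1152 * D" by simp
    show "Delta 0 ?F n = \<phi> (unit_vec n, 0)" for n
      using D by (simp add: Delta_scale F scaleC_seq)
  qed
qed

lemma functional_first_coordinate:
  assumes \<phi>: "bounded_functional \<phi> D" and D: "D > 0" and z: "\<And>n. \<phi> (unit_vec n, 0) = 0"
  shows "\<exists>F\<in>vecs Calderon. vnorm Calderon F \<le> 2304 * D \<and> Delta 0 F = 0 \<and> (\<forall>n. Delta 2 F n = \<phi> (0, unit_vec n))"
proof -
  have "bounded_functional (\<lambda>v. of_real (1 / (48 * D)) * \<phi> v) (1 / (48 * D) * D)"
    by (rule bounded_functional_mult[OF \<phi>]) (use D in simp)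
  then have "bounded_functional (\<lambda>v. of_real (1 / (48 * D)) * \<phi> v) (1/48)" using D by simp
  from functional_first_coordinate_small[OF this] obtain F where F: "F \<in> vecs Calderon"
    "vnorm Calderon F \<le> 48" "Delta 0 F = 0" "\<And>n. Delta 2 F n = of_real (1 / (48 * D)) * \<phi> (0, unit_vec n)"
    using z by auto
  show ?thesis
  proof (intro bexI conjI allI)
    let ?F = "of_real (48 * D) *\<^sub>C F"
    show "?F \<in> vecs Calderon" by (rule Calderon_scale[OF F(1)])
    have "vnorm Calderon ?F \<le> 48 * D * vnorm Calderon F"
      using Calderon_norm_scale[OF F(1), of "of_real (48 * D)"] D by (simp add: norm_mult)
    also have "\<dots> \<le> 48 * D * 48" using D F(2) by (intro mult_left_mono) auto
    finally show "vnorm Calderon ?F \<le> 2304 * D" by simp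
    show "Delta 0 ?F = 0"
      unfolding Delta_scale[OF F(1)] F(3) by (rule ext) (simp add: scaleC_seq)
    show "Delta 2 ?F n = \<phi> (0, unit_vec n)" for n
      using D by (simp add: Delta_scale F scaleC_seq)
  qed
qed

text \<open>Subtracting the functional of \<open>F\<close> enlarges the bound \<open>D\<close> to at
  most \<open>D + 4 * 1152 * D\<close>, and adding \<open>H\<close> leaves \<open>Delta 0 F\<close>
  intact because \<open>Delta 0 H = 0\<close>. The constant is 1152 + 2304 * (1 + 4 * 1152).\<close>

lemma functional_representation:
  assumes \<phi>: "bounded_functional \<phi> D" and D: "D > 0" and off: "\<And>v. v \<notin> vecs Wedge \<Longrightarrow> \<phi> v = 0"
  shows "\<exists>F\<in>vecs Calderon. vnorm Calderon F \<le> 10620288 * D \<and> pairing (Delta 2 F, Delta 0 F) = \<phi>"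
proof -
  obtain F where F: "F \<in> vecs Calderon" "vnorm Calderon F \<le> 1152 * D"
    "\<And>n. Delta 0 F n = \<phi> (unit_vec n, 0)"
    using functional_second_coordinate[OF \<phi> D] by blast
  let ?\<psi> = "\<lambda>v. \<phi> v - pairing (Delta 2 F, Delta 0 F) v"
  have "bounded_functional ?\<psi> (D + 4 * vnorm Calderon F)"
    by (rule bounded_functional_diff[OF \<phi> bounded_functional_pairing[OF F(1)]])
  moreover have "D + 4 * vnorm Calderon F > 0" using D Calderon_norm_nonneg[OF F(1)] by simp
  moreover have "?\<psi> (unit_vec n, 0) = 0" for n by (simp add: pairing_unit_vec F(3))
  ultimately obtain H where H: "H \<in> vecs Calderon" "vnorm Calderon H \<le> 2304 * (D + 4 * vnorm Calderon F)"
    "Delta 0 H = 0" "\<And>n. Delta 2 H n = ?\<psi> (0, unit_vec n)"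
    using functional_first_coordinate[of ?\<psi>] by blast
  have FH: "F + H \<in> vecs Calderon" by (rule Calderon_add[OF F(1) H(1)])
  let ?p = "(Delta 2 (F + H), Delta 0 (F + H))"
  have "pairing ?p v = \<phi> v" for v
  proof (cases "v \<in> vecs Wedge")
    case True
    have "\<phi> v - pairing ?p v = 0"
    proof (rule bounded_functional_zero[OF bounded_functional_diff[OF \<phi> bounded_functional_pairing[OF FH]] _ _ True])
      show "\<phi> (unit_vec n, 0) - pairing ?p (unit_vec n, 0) = 0" for n
        by (simp add: pairing_unit_vec Delta_add F H)
      show "\<phi> (0, unit_vec n) - pairing ?p (0, unit_vec n) = 0" for n
        by (simp add: pairing_unit_vec Delta_add F(1) H)
    qed
    then show ?thesis by simp
  next
    case False then show ?thesis by (simp add: off pairing_def)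
  qed
  moreover have "vnorm Calderon (F + H) \<le> 10620288 * D"
  proof -
    have "vnorm Calderon H \<le> 2304 * (D + 4 * (1152 * D))"
      by (rule order_trans[OF H(2)]) (use F(2) in simp)
    then show ?thesis using Calderon_norm_add[OF F(1) H(1)] F(2) by simp
  qed
  ultimately show ?thesis using FH by blast
qed

section \<open>The dual norm and the isomorphism\<close>

lemma vecs_dual_Wedge_iff:
  "\<phi> \<in> vecs (dual Wedge) \<longleftrightarrow> (\<exists>D. bounded_functional \<phi> D) \<and> (\<forall>v. v \<notin> vecs Wedge \<longrightarrow> \<phi> v = 0)"
proof -
  have "(\<exists>B. \<forall>v\<in>vecs Wedge. cmod (\<phi> v) \<le> B * vnorm Wedge v) \<longleftrightarrow>
    (\<exists>D\<ge>0. \<forall>v\<in>vecs Wedge. cmod (\<phi> v) \<le> D * vnorm Wedge v)"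
  proof safe
    fix B assume B: "\<forall>v\<in>vecs Wedge. cmod (\<phi> v) \<le> B * vnorm Wedge v"
    have "cmod (\<phi> v) \<le> max B 0 * vnorm Wedge v" if "v \<in> vecs Wedge" for v
      using B that mult_right_mono[of B "max B 0" "vnorm Wedge v"] Wedge_norm_nonneg[OF that]
      by (meson max.cobounded1 order_trans)
    then show "\<exists>D\<ge>0. \<forall>v\<in>vecs Wedge. cmod (\<phi> v) \<le> D * vnorm Wedge v"
      by (intro exI[of _ "max B 0"]) auto
  qed auto
  then show ?thesis by (auto simp: dual_def bounded_functional_def)
qed

text \<open>The dual norm is a supremum over the unit ball, which has to be nonempty.\<close>

lemma Wedge_zero: "(0, 0) \<in> vecs Wedge" and Wedge_norm_zero: "vnorm Wedge (0, 0) \<le> 0"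
proof -
  have D: "Delta k 0 = 0" for k
  proof -
    have "(0 :: complex) *\<^sub>C (0 :: complex \<Rightarrow> nat \<Rightarrow> complex) = 0" by (intro ext) (simp add: scaleC_coord)
    moreover have "(0 :: complex) *\<^sub>C Delta k 0 = 0" by (rule ext) (simp add: scaleC_seq)
    ultimately show ?thesis using Delta_scale[OF Calderon_zero, of k 0] by argo
  qed
  then show "(0, 0) \<in> vecs Wedge" unfolding vecs_Wedge_iff using Calderon_zero by (metis (no_types))
  have "vnorm Calderon 0 \<le> 0" by (rule Calderon_norm_le[OF Calderon_zero]) auto
  then show "vnorm Wedge (0, 0) \<le> 0" using Wedge_norm_le[OF Calderon_zero] D by simp
qed

lemma dual_norm_bound:
  assumes \<phi>: "\<phi> \<in> vecs (dual Wedge)"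
  shows "bounded_functional \<phi> (vnorm (dual Wedge) \<phi>)"
proof -
  obtain B where B: "bounded_functional \<phi> B" using \<phi> vecs_dual_Wedge_iff by blast
  let ?U = "{v \<in> vecs Wedge. vnorm Wedge v \<le> 1}"
  define D where "D = vnorm (dual Wedge) \<phi>"
  have D: "D = (SUP v\<in>?U. cmod (\<phi> v))" by (simp add: D_def dual_def)
  have "cmod (\<phi> v) \<le> B" if "v \<in> ?U" for v
  proof -
    have "cmod (\<phi> v) \<le> B * vnorm Wedge v" using B that by (simp add: bounded_functional_def)
    also have "\<dots> \<le> B * 1" using B that by (intro mult_left_mono) (auto simp: bounded_functional_def)
    finally show ?thesis by simp
  qed
  then have le: "cmod (\<phi> v) \<le> D" if "v \<in> ?U" for v
    unfolding D using that by (intro cSUP_upper bdd_aboveI2[where M = B]) auto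
  have "(0, 0) \<in> ?U" using Wedge_zero Wedge_norm_zero by simp
  then have D0: "D \<ge> 0" using le norm_ge_zero order_trans by blast
  have "cmod (\<phi> v) \<le> D * vnorm Wedge v" if v: "v \<in> vecs Wedge" for v
  proof (rule Wedge_norm_ge[OF v D0])
    fix G assume G: "G \<in> vecs Calderon" "Delta 1 G = 0" "v = (Delta 2 G, Delta 0 G)"
    show "cmod (\<phi> v) \<le> D * vnorm Calderon G"
    proof (rule field_le_epsilon)
      fix e :: real assume e: "e > 0"
      \<comment> \<open>Normalising by \<open>m\<close> works even if \<open>G\<close> has norm 0,
        and the surplus \<open>D * (e / (D + 1))\<close> is at most \<open>e\<close>.\<close>
      define m where "m = vnorm Calderon G + e / (D + 1)"
      have m: "m > 0" "vnorm Calderon G \<le> m"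
        using e D0 Calderon_norm_nonneg[OF G(1)] by (auto simp: m_def add_nonneg_pos)
      let ?c = "of_real (1 / m) :: complex"
      have cG: "?c *\<^sub>C G \<in> vecs Calderon" by (rule Calderon_scale[OF G(1)])
      have cv: "?c *\<^sub>C v = (Delta 2 (?c *\<^sub>C G), Delta 0 (?c *\<^sub>C G))"
        by (simp add: G(3) Delta_scale G(1) scaleC_prod_def)
      have d1: "Delta 1 (?c *\<^sub>C G) = 0"
        unfolding Delta_scale[OF G(1)] G(2) by (simp add: scaleC_fun_def scaleC_complex_def fun_eq_iff)
      have "vnorm Wedge (?c *\<^sub>C v) \<le> vnorm Calderon (?c *\<^sub>C G)"
        unfolding cv by (rule Wedge_norm_le[OF cG d1])
      also have "\<dots> \<le> cmod ?c * vnorm Calderon G" by (rule Calderon_norm_scale[OF G(1)])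
      also have "\<dots> \<le> 1" using m by (simp add: norm_divide)
      finally have "cmod (\<phi> (?c *\<^sub>C v)) \<le> D" using Wedge_scale[OF v] by (intro le) simp
      then have "cmod (\<phi> v) \<le> D * m"
        using m by (simp add: bounded_functional_scale[OF B v] norm_mult norm_divide field_simps)
      also have "\<dots> = D * vnorm Calderon G + D * (e / (D + 1))" by (simp add: m_def distrib_left)
      also have "D * (e / (D + 1)) \<le> e" using e D0 by (simp add: field_simps)
      finally show "cmod (\<phi> v) \<le> D * vnorm Calderon G + e" by simp
    qed
  qed
  then show ?thesis using B D0 by (simp add: bounded_functional_def D_def)
qed

theorem proposition6p2:
  "isomorphic (image_space (Delta_pair 2 0) Calderon (vecs Calderon)) (dual Wedge)"
proof -
  let ?X = "image_space (Delta_pair 2 0) Calderon (vecs Calderon)"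
  have X: "p \<in> vecs ?X \<longleftrightarrow> (\<exists>F\<in>vecs Calderon. p = (Delta 2 F, Delta 0 F))" for p
    by (auto simp: image_space_def Delta_pair_def)
  have X_mem: "(Delta 2 F, Delta 0 F) \<in> vecs ?X" if "F \<in> vecs Calderon" for F
    using that X by blast
  have summ: "summable (\<lambda>n. fst p n * snd v n + snd p n * fst v n)"
    if "p \<in> vecs ?X" "v \<in> vecs Wedge" for p v
    using that summable_pairing unfolding X by fastforce
  have add: "pairing (p + p') = pairing p + pairing p'" if "p \<in> vecs ?X" "p' \<in> vecs ?X" for p p'
  proof
    fix v show "pairing (p + p') v = (pairing p + pairing p') v"
      using suminf_add[OF summ[OF that(1), of v] summ[OF that(2), of v]]
      by (simp add: pairing_def algebra_simps)
  qed
  have scale: "pairing (c *\<^sub>C p) = c *\<^sub>C pairing p" if "p \<in> vecs ?X" for c p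
  proof
    fix v show "pairing (c *\<^sub>C p) v = (c *\<^sub>C pairing p) v"
      using suminf_mult[OF summ[OF that, of v], of c]
      by (simp add: pairing_def scaleC_prod_def scaleC_fun_def scaleC_complex_def algebra_simps)
  qed
  have inj: "inj_on pairing (vecs ?X)"
  proof (rule inj_onI)
    fix p p' assume "pairing p = pairing p'"
    then show "p = p'" by (metis ext pairing_unit_vec prod_eqI)
  qed
  have dual: "pairing p \<in> vecs (dual Wedge)" if "p \<in> vecs ?X" for p
    using that bounded_functional_pairing unfolding X vecs_dual_Wedge_iff by (auto simp: pairing_def)
  \<comment> \<open>The slack \<open>e\<close> is added because the representation asks for a
    positive bound, whereas the dual norm may be 0.\<close>
  have rep: "\<exists>F\<in>vecs Calderon. vnorm Calderon F \<le> 10620288 * (vnorm (dual Wedge) \<phi> + e) \<and>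
      pairing (Delta 2 F, Delta 0 F) = \<phi>"
    if \<phi>: "\<phi> \<in> vecs (dual Wedge)" and e: "e > 0" for \<phi> e
  proof (rule functional_representation)
    have b: "bounded_functional \<phi> (vnorm (dual Wedge) \<phi>)" by (rule dual_norm_bound[OF \<phi>])
    then show "vnorm (dual Wedge) \<phi> + e > 0" using e by (simp add: bounded_functional_def add_nonneg_pos)
    show "bounded_functional \<phi> (vnorm (dual Wedge) \<phi> + e)"
    proof -
      have "cmod (\<phi> v) \<le> (vnorm (dual Wedge) \<phi> + e) * vnorm Wedge v" if v: "v \<in> vecs Wedge" for v
      proof -
        have "0 \<le> e * vnorm Wedge v" using e Wedge_norm_nonneg[OF v] by simp
        moreover have "cmod (\<phi> v) \<le> vnorm (dual Wedge) \<phi> * vnorm Wedge v"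
          using b v by (simp add: bounded_functional_def)
        ultimately show ?thesis by (simp add: distrib_right)
      qed
      then show ?thesis using b e by (simp add: bounded_functional_def)
    qed
    show "\<phi> v = 0" if "v \<notin> vecs Wedge" for v using \<phi> that vecs_dual_Wedge_iff by blast
  qed
  have bij: "bij_betw pairing (vecs ?X) (vecs (dual Wedge))"
    unfolding bij_betw_def
  proof (intro conjI inj equalityI subsetI)
    show "\<phi> \<in> vecs (dual Wedge)" if "\<phi> \<in> pairing ` vecs ?X" for \<phi> using that dual by blast
    show "\<phi> \<in> pairing ` vecs ?X" if "\<phi> \<in> vecs (dual Wedge)" for \<phi>
      using rep[OF that zero_less_one] X_mem by blast
  qed
  have bound: "vnorm (dual Wedge) (pairing p) \<le> 4 * vnorm ?X p" if p: "p \<in> vecs ?X" for p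
  proof -
    have "(SUP v\<in>{v \<in> vecs Wedge. vnorm Wedge v \<le> 1}. cmod (pairing p v)) \<le> 4 * vnorm ?X p"
    proof (rule cSUP_least)
      show "{v \<in> vecs Wedge. vnorm Wedge v \<le> 1} \<noteq> {}"
        using Wedge_zero Wedge_norm_zero by force
      fix v assume v: "v \<in> {v \<in> vecs Wedge. vnorm Wedge v \<le> 1}"
      show "cmod (pairing p v) \<le> 4 * vnorm ?X p"
      proof (rule image_space_norm_ge)
        show "p \<in> Delta_pair 2 0 ` vecs Calderon" using p by (simp add: image_space_def)
        fix F assume F: "F \<in> vecs Calderon" "Delta_pair 2 0 F = p"
        have "cmod (pairing p v) \<le> 4 * vnorm Calderon F * vnorm Wedge v"
          using pairing_le[OF F(1), of v] v F(2) by (simp add: Delta_pair_def)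
        also have "\<dots> \<le> 4 * vnorm Calderon F * 1"
          using v Calderon_norm_nonneg[OF F(1)] by (intro mult_left_mono) auto
        finally show "cmod (pairing p v) \<le> 4 * vnorm Calderon F" by simp
      qed simp
    qed
    then show ?thesis by (simp add: dual_def)
  qed
  \<comment> \<open>One representing \<open>F\<close> estimates the quotient norm of the preimage;
    dividing the slack by the constant makes exactly \<open>e\<close> remain.\<close>
  have bound_inv: "vnorm ?X (inv_into (vecs ?X) pairing \<phi>) \<le> 10620288 * vnorm (dual Wedge) \<phi>"
    if \<phi>: "\<phi> \<in> vecs (dual Wedge)" for \<phi>
  proof (rule field_le_epsilon)
    fix e :: real assume e: "e > 0"
    then obtain F where F: "F \<in> vecs Calderon" "pairing (Delta 2 F, Delta 0 F) = \<phi>"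
      "vnorm Calderon F \<le> 10620288 * (vnorm (dual Wedge) \<phi> + e / 10620288)"
      using rep[OF \<phi>, of "e / 10620288"] by auto
    have "inv_into (vecs ?X) pairing \<phi> = Delta_pair 2 0 F"
      using inv_into_f_f[OF inj X_mem[OF F(1)]] F(2) by (simp add: Delta_pair_def)
    also have "vnorm ?X (Delta_pair 2 0 F) \<le> vnorm Calderon F"
      by (rule image_space_norm_le[OF F(1) Calderon_norm_nonneg])
    finally show "vnorm ?X (inv_into (vecs ?X) pairing \<phi>) \<le> 10620288 * vnorm (dual Wedge) \<phi> + e"
      using F(3) by simp
  qed
  show ?thesis unfolding isomorphic_def clinear_on_def
    using add scale bij bound bound_inv by blast
qed

end
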